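(* Assume that the Markov chains $\{\tilde{\boldsymbol Y}_n\}$, $\{\tilde{\boldsymbol Y}^{(1)}_n\}$ and $\{\tilde{\boldsymbol Y}^{(2)}_n\}$ are irreducible and aperiodic. Then for any $z\in\mathbb{C}$ with $\underline z_1^*<|z|\le\bar z_1^*$ and $z\ne|z|$, $$\mathrm{spr}\big(C_1(z,G_1(z))\big)<\mathrm{spr}\big(C_1(|z|,G_1(|z|))\big).$$
   Context: Let $\mathbb{H}=\{-1,0,1\}$, $\mathbb{H}_+=\{0,1\}$, and let $S_0=\{1,\dots,s_0\}$ be finite. Let $A_{i,j}$ ($i,j\in\mathbb{H}$), $A^{(1)}_{i,j}$ ($i\in\mathbb{H},j\in\mathbb{H}_+$), $A^{(2)}_{i,j}$ ($i\in\mathbb{H}_+,j\in\mathbb{H}$) be nonnegative $s_0\times s_0$ matrices such that $\sum A_{i,j}$, $\sum A^{(1)}_{i,j}$, $\sum A^{(2)}_{i,j}$ are stochastic. $\{\tilde{\boldsymbol Y}_n\}$ is the Markov chain on $\mathbb{Z}^2\times S_0$ whose transition block from $(x_1,x_2)$ to $(x_1+i,x_2+j)$ is $A_{i,j}$ ($i,j\in\mathbb H$); $\{\tilde{\boldsymbol Y}^{(1)}_n\}$ is the chain on $\mathbb{Z}\times\mathbb{Z}_+\times S_0$ whose block is $A_{i,j}$ if $x_2\ne0$ and $A^{(1)}_{i,j}$ if $x_2=0$; $\{\tilde{\boldsymbol Y}^{(2)}_n\}$ is the chain on $\mathbb{Z}_+\times\mathbb{Z}\times S_0$ whose block is $A_{i,j}$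 if $x_1\neq0$ and $A^{(2)}_{i,j}$ if $x_1=0$; all other blocks are zero. $\mathrm{spr}$ denotes spectral radius. Let $C(z,w)=\sum_{i,j\in\mathbb{H}}A_{i,j}z^iw^j$; $\log\underline z_1^*$ and $\log\bar z_1^*$ are the minimum and maximum of $s_1$ over the compact set $\{(s_1,s_2)\in\mathbb{R}^2:\mathrm{spr}(C(e^{s_1},e^{s_2}))\le1\}$. With $A_{*,j}(z)=\sum_{i\in\mathbb{H}}A_{i,j}z^i$, for $\underline z_1^*\le|z|\le\bar z_1^*$ define $G_1(z)=\sum_{n\ge1}\sum A_{*,i_1}(z)\cdots A_{*,i_n}(z)$, the inner sum being over $(i_1,\dots,i_n)\in\mathbb{H}^n$ with $\sum_{l=1}^ki_l\ge0$ for $1\le k\le n-1$ and $\sum_{l=1}^ni_l=-1$; this series converges absolutely, and for real positive $z$ it is the minimal nonnegative solution of $A_{*,-1}(z)+A_{*,0}(z)X+A_{*,1}(z)X^2=X$. For an $s_0\times s_0$ matrix $X$, $C_1(z,X)=A^{(1)}_{*,0}(z)+A^{(1)}_{*,1}(z)X$, where $A^{(1)}_{*,i}(z)=\sum_{j\in\mathbb{H}}A^{(1)}_{j,i}z^j$, $i\in\mathbb{H}_+$. *)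

theory Defs
  imports
    Complex_Main
    "HOL-Analysis.Infinite_Sum"
    "Jordan_Normal_Form.Spectral_Radius"
begin

text \<open>The phase set \<open>S\<^sub>0\<close> with \<open>s0\<close> elements is represented by the index set \<open>{..<s0}\<close> of the matrix
  library, that is, phases are numbered from 0. Families of blocks are functions
  \<open>int \<Rightarrow> int \<Rightarrow> real mat\<close>, of which only the values on the stated index sets matter.\<close>

definition H :: "int set" where "H = {-1, 0, 1}"

definition Hplus :: "int set" where "Hplus = {0, 1}"

definition nonneg_blocks ::
  "nat \<Rightarrow> int set \<Rightarrow> int set \<Rightarrow> (int \<Rightarrow> int \<Rightarrow> real mat) \<Rightarrow> bool" where
  "nonneg_blocks s0 I J A \<longleftrightarrow> (\<forall>i\<in>I. \<forall>j\<in>J.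
     A i j \<in> carrier_mat s0 s0 \<and> (\<forall>k<s0. \<forall>l<s0. 0 \<le> A i j $$ (k, l)))"

definition block_sum ::
  "nat \<Rightarrow> int set \<Rightarrow> int set \<Rightarrow> (int \<Rightarrow> int \<Rightarrow> real mat) \<Rightarrow> real mat" where
  "block_sum s0 I J A = mat s0 s0 (\<lambda>(k, l). \<Sum>i\<in>I. \<Sum>j\<in>J. A i j $$ (k, l))"

definition stochastic_mat :: "nat \<Rightarrow> real mat \<Rightarrow> bool" where
  "stochastic_mat s0 M \<longleftrightarrow> M \<in> carrier_mat s0 s0 \<and>
     (\<forall>k<s0. \<forall>l<s0. 0 \<le> M $$ (k, l)) \<and> (\<forall>k<s0. (\<Sum>l<s0. M $$ (k, l)) = 1)"

text \<open>A time-homogeneous Markov chain is given by its countable state space \<open>S\<close> and its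
  one-step transition probabilities \<open>P x y\<close>.\<close>

primrec nstep :: "'s set \<Rightarrow> ('s \<Rightarrow> 's \<Rightarrow> real) \<Rightarrow> nat \<Rightarrow> 's \<Rightarrow> 's \<Rightarrow> real" where
  "nstep S P 0 x y = (if x = y then 1 else 0)"
| "nstep S P (Suc n) x y = (\<Sum>\<^sub>\<infinity>u\<in>S. P x u * nstep S P n u y)"

definition irreducible_chain :: "'s set \<Rightarrow> ('s \<Rightarrow> 's \<Rightarrow> real) \<Rightarrow> bool" where
  "irreducible_chain S P \<longleftrightarrow> (\<forall>x\<in>S. \<forall>y\<in>S. \<exists>n. 0 < nstep S P n x y)"

definition aperiodic_chain :: "'s set \<Rightarrow> ('s \<Rightarrow> 's \<Rightarrow> real) \<Rightarrow> bool" where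
  "aperiodic_chain S P \<longleftrightarrow> (\<forall>x\<in>S. Gcd {n. 0 < n \<and> 0 < nstep S P n x x} = 1)"

type_synonym state = "int \<times> int \<times> nat"

definition states0 :: "nat \<Rightarrow> state set" where
  "states0 s0 = UNIV \<times> UNIV \<times> {..<s0}"

definition states1 :: "nat \<Rightarrow> state set" where
  "states1 s0 = UNIV \<times> {0..} \<times> {..<s0}"

definition states2 :: "nat \<Rightarrow> state set" where
  "states2 s0 = {0..} \<times> UNIV \<times> {..<s0}"

text \<open>The entry of the block leading from \<open>(x\<^sub>1, x\<^sub>2)\<close> to \<open>(y\<^sub>1, y\<^sub>2)\<close>
  when the increments are restricted to \<open>I \<times> J\<close>.\<close>

definition jump ::
  "int set \<Rightarrow> int set \<Rightarrow> (int \<Rightarrow> int \<Rightarrow> real mat) \<Rightarrow> state \<Rightarrow> state \<Rightarrow> real" where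
  "jump I J A = (\<lambda>(x1, x2, k) (y1, y2, l).
     if y1 - x1 \<in> I \<and> y2 - x2 \<in> J then A (y1 - x1) (y2 - x2) $$ (k, l) else 0)"

definition trans0 :: "(int \<Rightarrow> int \<Rightarrow> real mat) \<Rightarrow> state \<Rightarrow> state \<Rightarrow> real" where
  "trans0 A x y = jump H H A x y"

definition trans1 ::
  "(int \<Rightarrow> int \<Rightarrow> real mat) \<Rightarrow> (int \<Rightarrow> int \<Rightarrow> real mat) \<Rightarrow> state \<Rightarrow> state \<Rightarrow> real" where
  "trans1 A A1 x y = (if fst (snd x) \<noteq> 0 then jump H H A x y else jump H Hplus A1 x y)"

definition trans2 ::
  "(int \<Rightarrow> int \<Rightarrow> real mat) \<Rightarrow> (int \<Rightarrow> int \<Rightarrow> real mat) \<Rightarrow> state \<Rightarrow> state \<Rightarrow> real" where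
  "trans2 A A2 x y = (if fst x \<noteq> 0 then jump H H A x y else jump Hplus H A2 x y)"

definition C :: "nat \<Rightarrow> (int \<Rightarrow> int \<Rightarrow> real mat) \<Rightarrow> complex \<Rightarrow> complex \<Rightarrow> complex mat" where
  "C s0 A z w = mat s0 s0 (\<lambda>(k, l).
     \<Sum>i\<in>H. \<Sum>j\<in>H. complex_of_real (A i j $$ (k, l)) * z powi i * w powi j)"

definition Gamma_region :: "nat \<Rightarrow> (int \<Rightarrow> int \<Rightarrow> real mat) \<Rightarrow> (real \<times> real) set" where
  "Gamma_region s0 A = {(s1, s2).
     spectral_radius (C s0 A (complex_of_real (exp s1)) (complex_of_real (exp s2))) \<le> 1}"

text \<open>Under irreducibility of the chain on \<open>\<int>\<^sup>2 \<times> S\<^sub>0\<close> the region is compact and contains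
  \<open>(0, 0)\<close>, so the infimum and supremum below are the minimum and maximum.\<close>

definition z1_min :: "nat \<Rightarrow> (int \<Rightarrow> int \<Rightarrow> real mat) \<Rightarrow> real" where
  "z1_min s0 A = exp (INF s\<in>Gamma_region s0 A. fst s)"

definition z1_max :: "nat \<Rightarrow> (int \<Rightarrow> int \<Rightarrow> real mat) \<Rightarrow> real" where
  "z1_max s0 A = exp (SUP s\<in>Gamma_region s0 A. fst s)"

text \<open>\<open>A\<^sub>*\<^sub>,\<^sub>j(z)\<close>; also used for the boundary family \<open>A\<^sup>(\<^sup>1\<^sup>)\<close>, where the second index
  ranges over \<open>Hplus\<close>.\<close>

definition Astar :: "nat \<Rightarrow> (int \<Rightarrow> int \<Rightarrow> real mat) \<Rightarrow> int \<Rightarrow> complex \<Rightarrow> complex mat" where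
  "Astar s0 A j z = mat s0 s0 (\<lambda>(k, l).
     \<Sum>i\<in>H. complex_of_real (A i j $$ (k, l)) * z powi i)"

definition first_passage :: "nat \<Rightarrow> int list set" where
  "first_passage n = {is. length is = n \<and> set is \<subseteq> H \<and>
     (\<forall>k\<in>{1..n - 1}. 0 \<le> sum_list (take k is)) \<and> sum_list is = -1}"

definition path_prod ::
  "nat \<Rightarrow> (int \<Rightarrow> int \<Rightarrow> real mat) \<Rightarrow> complex \<Rightarrow> int list \<Rightarrow> complex mat" where
  "path_prod s0 A z is = foldr (\<lambda>i M. Astar s0 A i z * M) is (1\<^sub>m s0)"

text \<open>The matrix series is taken entrywise; the summation index is shifted so that
  path lengths start at 1.\<close>

definition G1 :: "nat \<Rightarrow> (int \<Rightarrow> int \<Rightarrow> real mat) \<Rightarrow> complex \<Rightarrow> complex mat" where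
  "G1 s0 A z = mat s0 s0 (\<lambda>(k, l).
     \<Sum>n. \<Sum>is\<in>first_passage (Suc n). path_prod s0 A z is $$ (k, l))"

definition C1 ::
  "nat \<Rightarrow> (int \<Rightarrow> int \<Rightarrow> real mat) \<Rightarrow> complex \<Rightarrow> complex mat \<Rightarrow> complex mat" where
  "C1 s0 A1 z X = Astar s0 A1 0 z + Astar s0 A1 1 z * X"

end

(* Write r = |z|. Each entry of C_1(z, G_1(z)) is a series over excursions of the boundary chain
   away from level 0, an excursion with horizontal displacement d contributing a nonnegative weight
   times z^d. Hence |C_1(z, G_1(z))| <= Q := C_1(r, G_1(r)) entrywise, and by Wielandt's theorem it is
   enough that Q is irreducible and that one of these inequalities is strict. Irreducibility is
   inherited from the chain on the half plane. For strictness, follow an excursion that climbs to a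
   great height and insert there a loop of the free chain with displacement 1: the two resulting
   excursions contribute to the same entry with phases differing by z/r, which is not 1.
   Convergence of G_1(r) up to the end point r = z1_max follows from vectors that are subinvariant
   up to a factor exp eta: they exist for every eta > 0 by convexity of exp, and irreducibility
   bounds the ratios of their entries uniformly in eta. *)

theory Submission
  imports Defs "HOL-Analysis.Convex"
begin

section \<open>Strict monotonicity of the spectral radius\<close>

text \<open>Real matrices are kept as functions on indices, which makes sums and inequalities plain
  real ones; the spectral radius is only available for complex matrices.\<close>

abbreviation cmat :: "nat \<Rightarrow> (nat \<Rightarrow> nat \<Rightarrow> real) \<Rightarrow> complex mat" where
  "cmat n q \<equiv> mat n n (\<lambda>(k, l). complex_of_real (q k l))"

section \<open>Eigenvalues in coordinates\<close>

lemma eigenvalue_coords: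
  fixes M :: "complex mat"
  assumes "M \<in> carrier_mat n n"
  shows "eigenvalue M c \<longleftrightarrow>
    (\<exists>f. (\<exists>k<n. f k \<noteq> 0) \<and> (\<forall>k<n. (\<Sum>l<n. M $$ (k, l) * f l) = c * f k))"
proof
  assume "eigenvalue M c"
  then obtain v where v: "v \<in> carrier_vec n" "v \<noteq> 0\<^sub>v n" "M *\<^sub>v v = c \<cdot>\<^sub>v v"
    using assms by (auto simp: eigenvalue_def eigenvector_def)
  have "(\<Sum>l<n. M $$ (k, l) * v $ l) = c * v $ k" if "k < n" for k
  proof -
    have "(M *\<^sub>v v) $ k = (\<Sum>l<n. M $$ (k, l) * v $ l)"
      using that v(1) assms by (auto simp: scalar_prod_def lessThan_atLeast0 intro!: sum.cong)
    then show ?thesis using v that by auto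
  qed
  moreover have "\<exists>k<n. v $ k \<noteq> 0" using v(1,2) by auto
  ultimately show "\<exists>f. (\<exists>k<n. f k \<noteq> 0) \<and> (\<forall>k<n. (\<Sum>l<n. M $$ (k, l) * f l) = c * f k)"
    by (intro exI[of _ "\<lambda>k. v $ k"]) auto
next
  assume "\<exists>f. (\<exists>k<n. f k \<noteq> 0) \<and> (\<forall>k<n. (\<Sum>l<n. M $$ (k, l) * f l) = c * f k)"
  then obtain f where f: "\<exists>k<n. f k \<noteq> 0" "\<And>k. k < n \<Longrightarrow> (\<Sum>l<n. M $$ (k, l) * f l) = c * f k"
    by auto
  have "M *\<^sub>v vec n f = c \<cdot>\<^sub>v vec n f"
  proof (rule eq_vecI)
    fix k assume "k < dim_vec (c \<cdot>\<^sub>v vec n f)"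
    then have k: "k < n" by simp
    have "(M *\<^sub>v vec n f) $ k = (\<Sum>l<n. M $$ (k, l) * f l)"
      using k assms by (auto simp: scalar_prod_def lessThan_atLeast0 intro!: sum.cong)
    then show "(M *\<^sub>v vec n f) $ k = (c \<cdot>\<^sub>v vec n f) $ k" using f(2)[OF k] k by simp
  qed (use assms in auto)
  moreover have "vec n f \<noteq> 0\<^sub>v n" using f(1) by (metis index_vec index_zero_vec(1))
  ultimately show "eigenvalue M c"
    using assms by (auto simp: eigenvalue_def eigenvector_def intro!: exI[of _ "vec n f"])
qed

lemma cmod_eigenvalue_le_spectral_radius:
  assumes "M \<in> carrier_mat n n" "0 < n" "eigenvalue M c"
  shows "cmod c \<le> spectral_radius M"
  using spectral_radius_mem_max(2)[OF assms(1,2)] assms(3) by (auto simp: spectrum_def)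

lemma spectral_radius_eigenvalue:
  assumes "M \<in> carrier_mat n n" "0 < n"
  obtains c where "eigenvalue M c" "cmod c = spectral_radius M"
  using spectral_radius_mem_max(1)[OF assms] by (auto simp: spectrum_def)

lemma spectral_radius_nonneg:
  assumes "M \<in> carrier_mat n n" "0 < n"
  shows "0 \<le> spectral_radius M"
  by (metis assms norm_ge_zero spectral_radius_eigenvalue)

lemma spectral_radius_transpose:
  assumes "M \<in> carrier_mat n n"
  shows "spectral_radius (transpose_mat M) = spectral_radius M"
  using assms
  by (simp add: spectral_radius_def spectrum_root_char_poly[of _ n] char_poly_transpose_mat)

primrec row_iter :: "nat \<Rightarrow> (nat \<Rightarrow> nat \<Rightarrow> real) \<Rightarrow> nat \<Rightarrow> nat \<Rightarrow> real" where
  "row_iter n q 0 l = 1"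
| "row_iter n q (Suc m) l = (\<Sum>k<n. row_iter n q m k * q k l)"

text \<open>\<open>row_iter n q m\<close> is the row vector 1 q^m, with 1 the all-ones row. Written
  with the powers of q / c, it inherits the known boundedness of the powers of a matrix with
  spectral radius below 1.\<close>

lemma row_iter_eq:
  assumes "c \<noteq> 0" "l < n"
  shows "complex_of_real (row_iter n q m l) =
    of_real c ^ m * (\<Sum>k<n. ((of_real (1 / c) \<cdot>\<^sub>m cmat n q) ^\<^sub>m m) $$ (k, l))"
  using assms(2)
proof (induction m arbitrary: l)
  case 0
  then show ?case by (simp add: one_mat_def)
next
  case (Suc m)
  let ?B = "of_real (1 / c) \<cdot>\<^sub>m cmat n q :: complex mat"
  have B: "?B \<in> carrier_mat n n" by simp
  have e: "(?B ^\<^sub>m Suc m) $$ (k, l) = (\<Sum>i<n. (?B ^\<^sub>m m) $$ (k, i) * of_real (q i l / c))"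
    if "k < n" for k
    using that Suc.prems by (simp add: scalar_prod_def lessThan_atLeast0)
  have "of_real c ^ Suc m * (\<Sum>k<n. (?B ^\<^sub>m Suc m) $$ (k, l))
     = of_real c ^ Suc m * (\<Sum>k<n. \<Sum>i<n. (?B ^\<^sub>m m) $$ (k, i) * of_real (q i l / c))"
    using e by (intro arg_cong2[where f = "(*)"] sum.cong refl) auto
  also have "\<dots> = (\<Sum>k<n. \<Sum>i<n. of_real c ^ m * (?B ^\<^sub>m m) $$ (k, i) * of_real (q i l))"
    unfolding sum_distrib_left using assms(1) by (intro sum.cong refl) simp
  also have "\<dots> = (\<Sum>i<n. (of_real c ^ m * (\<Sum>k<n. (?B ^\<^sub>m m) $$ (k, i))) * of_real (q i l))"
    by (subst sum.swap) (simp add: sum_distrib_left sum_distrib_right)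
  also have "\<dots> = (\<Sum>i<n. of_real (row_iter n q m i) * of_real (q i l))"
    using Suc.IH by (intro sum.cong) auto
  finally show ?case by simp
qed

text \<open>The vector is the row vector \<open>\<Sum>\<^sub>m c\<^sup>-\<^sup>m 1 q\<^sup>m\<close>, a Neumann series.\<close>

lemma left_subinvariant:
  assumes "0 < n" and q: "\<And>k l. k < n \<Longrightarrow> l < n \<Longrightarrow> 0 \<le> q k l"
    and sr: "spectral_radius (cmat n q) < c"
  obtains u :: "nat \<Rightarrow> real" where "\<And>k. k < n \<Longrightarrow> 0 < u k"
    "\<And>l. l < n \<Longrightarrow> (\<Sum>k<n. u k * q k l) \<le> c * u l"
proof -
  \<comment> \<open>The intermediate \<open>c'\<close> does two things: the powers of q / c' are
    bounded, and c' / c < 1 makes the Neumann series converge geometrically.\<close>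
  obtain c' where c': "spectral_radius (cmat n q) < c'" "c' < c" using dense sr by blast
  have "0 \<le> spectral_radius (cmat n q)"
    by (rule spectral_radius_nonneg[of _ n]) (use assms in auto)
  then have pos: "0 < c'" "0 < c" using c' by auto
  let ?B = "of_real (1 / c') \<cdot>\<^sub>m cmat n q :: complex mat"
  have B: "?B \<in> carrier_mat n n" by simp
  have "spectral_radius ?B < 1"
  proof -
    obtain \<mu> where \<mu>: "eigenvalue ?B \<mu>" "cmod \<mu> = spectral_radius ?B"
      using spectral_radius_eigenvalue[OF B assms(1)] .
    then obtain f where f: "\<exists>k<n. f k \<noteq> 0"
      "\<And>k. k < n \<Longrightarrow> (\<Sum>l<n. ?B $$ (k, l) * f l) = \<mu> * f k"
      unfolding eigenvalue_coords[OF B] by auto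
    have "(\<Sum>l<n. cmat n q $$ (k, l) * f l) = (of_real c' * \<mu>) * f k" if "k < n" for k
    proof -
      have e: "of_real c' * (\<Sum>l<n. ?B $$ (k, l) * f l) = (\<Sum>l<n. cmat n q $$ (k, l) * f l)"
        using that pos by (simp add: sum_distrib_left)
      show ?thesis unfolding mult.assoc f(2)[OF that, symmetric] by (rule e[symmetric])
    qed
    then have "eigenvalue (cmat n q) (of_real c' * \<mu>)"
      using f(1) by (subst eigenvalue_coords[of _ n]) auto
    then have "cmod (of_real c' * \<mu>) \<le> spectral_radius (cmat n q)"
      by (intro cmod_eigenvalue_le_spectral_radius[of _ n]) (use assms in auto)
    then have "c' * spectral_radius ?B < c' * 1"
      unfolding norm_mult \<mu>(2) norm_of_real using c'(1) pos by linarith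
    then show ?thesis using pos(1) by (simp only: mult_less_cancel_left_pos)
  qed
  then obtain b where b: "\<And>m. norm_bound (?B ^\<^sub>m m) b"
    using spectral_radius_jnf_norm_bound_less_1_upper_triangular[OF B] by auto
  let ?p = "row_iter n q"
  have p0: "0 \<le> ?p m l" if "l < n" for m l
    using that by (induction m arbitrary: l) (auto intro!: sum_nonneg mult_nonneg_nonneg q)
  have pb: "?p m l \<le> c' ^ m * (n * b)" if "l < n" for m l
  proof -
    have "?p m l = cmod (of_real (?p m l))" using p0 that by simp
    also have "\<dots> = c' ^ m * cmod (\<Sum>k<n. (?B ^\<^sub>m m) $$ (k, l))"
      using pos that by (simp only: row_iter_eq[of c'] norm_mult norm_power) simp
    also have "cmod (\<Sum>k<n. (?B ^\<^sub>m m) $$ (k, l)) \<le> of_nat (card {..<n}) * b"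
      using b[of m] that B by (intro sum_norm_bound) (auto simp: norm_bound_def)
    finally show ?thesis using pos by simp
  qed
  have sm: "summable (\<lambda>m. ?p m l / c ^ m)" if "l < n" for l
  proof (rule summable_comparison_test')
    show "summable (\<lambda>m. n * b * (c' / c) ^ m)"
      using pos c'(2) by (intro summable_mult summable_geometric) auto
    show "norm (?p m l / c ^ m) \<le> n * b * (c' / c) ^ m" if "m \<ge> 0" for m
      using pb[OF \<open>l < n\<close>, of m] p0[OF \<open>l < n\<close>] pos
      by (simp add: power_divide divide_right_mono ac_simps)
  qed
  have smS: "summable (\<lambda>m. ?p (Suc m) l / c ^ Suc m)" if "l < n" for l
    using sm[OF that] summable_Suc_iff[of "\<lambda>m. ?p m l / c ^ m"] by blast
  define u where "u l = (\<Sum>m. ?p m l / c ^ m)" for l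
  \<comment> \<open>The term of index 0 is 1. The remaining series is nonnegative, whence
    \<open>u\<close> is positive, and c times it is exactly the row vector u q.\<close>
  have u_ge: "u l = 1 + (\<Sum>m. ?p (Suc m) l / c ^ Suc m)" if "l < n" for l
    using suminf_split_head[OF sm[OF that]] by (simp add: u_def)
  show thesis
  proof
    show "0 < u l" if "l < n" for l
    proof -
      have "0 \<le> (\<Sum>m. ?p (Suc m) l / c ^ Suc m)"
        using that p0 pos by (intro suminf_nonneg smS) (auto simp del: row_iter.simps power_Suc)
      then show ?thesis using u_ge[OF that] by linarith
    qed
    show "(\<Sum>k<n. u k * q k l) \<le> c * u l" if "l < n" for l
    proof -
      have "(\<Sum>k<n. u k * q k l) = (\<Sum>k<n. \<Sum>m. ?p m k / c ^ m * q k l)"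
        unfolding u_def by (intro sum.cong suminf_mult2 sm) auto
      also have "\<dots> = (\<Sum>m. \<Sum>k<n. ?p m k / c ^ m * q k l)"
        by (intro suminf_sum[symmetric] summable_mult2 sm) auto
      also have "\<dots> = (\<Sum>m. c * (?p (Suc m) l / c ^ Suc m))"
        using pos by (intro suminf_cong) (simp add: sum_divide_distrib sum_distrib_left)
      also have "\<dots> = c * (\<Sum>m. ?p (Suc m) l / c ^ Suc m)"
        by (intro suminf_mult smS that)
      also have "\<dots> \<le> c * u l" using u_ge[OF that] pos by simp
      finally show ?thesis .
    qed
  qed
qed

lemma right_subinvariant:
  assumes "0 < n" and q: "\<And>k l. k < n \<Longrightarrow> l < n \<Longrightarrow> 0 \<le> q k l"
    and sr: "spectral_radius (cmat n q) < c"
  obtains v :: "nat \<Rightarrow> real" where "\<And>k. k < n \<Longrightarrow> 0 < v k"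
    "\<And>k. k < n \<Longrightarrow> (\<Sum>l<n. q k l * v l) \<le> c * v k"
proof -
  have "cmat n (\<lambda>k l. q l k) = transpose_mat (cmat n q)" by (intro eq_matI) auto
  then have "spectral_radius (cmat n (\<lambda>k l. q l k)) < c"
    using sr spectral_radius_transpose[of "cmat n q" n] by simp
  then obtain v :: "nat \<Rightarrow> real" where v: "\<And>k. k < n \<Longrightarrow> 0 < v k"
    "\<And>k. k < n \<Longrightarrow> (\<Sum>l<n. v l * q k l) \<le> c * v k"
    using left_subinvariant[of n "\<lambda>k l. q l k" c] assms(1) q by blast
  show thesis using that[of v] v by (simp add: mult.commute)
qed

text \<open>The Collatz-Wielandt bound: let \<open>t\<close> be the least number with |f| \<le> t v
  for an eigenvector \<open>f\<close>, and read the eigenvalue equation at an index where equality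
  holds.\<close>

lemma spectral_radius_le:
  assumes "0 < n" and q: "\<And>k l. k < n \<Longrightarrow> l < n \<Longrightarrow> 0 \<le> q k l"
    and v: "\<And>k. k < n \<Longrightarrow> 0 < v k" "\<And>k. k < n \<Longrightarrow> (\<Sum>l<n. q k l * v l) \<le> c * v k"
  shows "spectral_radius (cmat n q) \<le> c"
proof -
  have Q: "cmat n q \<in> carrier_mat n n" by simp
  obtain \<mu> where \<mu>: "eigenvalue (cmat n q) \<mu>" "cmod \<mu> = spectral_radius (cmat n q)"
    using spectral_radius_eigenvalue[OF Q assms(1)] .
  then obtain f where f: "\<exists>k<n. f k \<noteq> 0"
    "\<And>k. k < n \<Longrightarrow> (\<Sum>l<n. cmat n q $$ (k, l) * f l) = \<mu> * f k"
    unfolding eigenvalue_coords[OF Q] by auto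
  define t where "t = Max ((\<lambda>k. cmod (f k) / v k) ` {..<n})"
  have fin: "finite ((\<lambda>k. cmod (f k) / v k) ` {..<n})" "(\<lambda>k. cmod (f k) / v k) ` {..<n} \<noteq> {}"
    using assms(1) by auto
  obtain k where k: "k < n" "t = cmod (f k) / v k" using Max_in[OF fin] by (auto simp: t_def)
  have le: "cmod (f l) \<le> t * v l" if "l < n" for l
  proof -
    have "cmod (f l) / v l \<le> t" unfolding t_def using fin that by (intro Max_ge) auto
    then show ?thesis using v(1)[OF that] by (simp add: divide_le_eq)
  qed
  have "0 \<le> t" using k v(1) by (simp add: less_imp_le)
  have "t \<noteq> 0" using f(1) le by (metis mult_zero_left norm_le_zero_iff)
  with \<open>0 \<le> t\<close> k v(1) have fk: "0 < cmod (f k)" by auto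
  have "cmod \<mu> * cmod (f k) = cmod (\<Sum>l<n. of_real (q k l) * f l)"
    using f(2)[OF k(1)] k(1) by (simp add: norm_mult)
  also have "\<dots> \<le> (\<Sum>l<n. q k l * cmod (f l))"
    using q k by (intro order_trans[OF norm_sum] sum_mono) (auto simp: norm_mult)
  also have "\<dots> \<le> (\<Sum>l<n. q k l * (t * v l))"
    using q k le by (intro sum_mono mult_left_mono) auto
  also have "\<dots> = t * (\<Sum>l<n. q k l * v l)" by (simp add: sum_distrib_left ac_simps)
  also have "\<dots> \<le> t * (c * v k)" using v(2)[OF k(1)] \<open>0 \<le> t\<close> by (intro mult_left_mono)
  also have "\<dots> = c * cmod (f k)" using k v(1)[OF k(1)] by simp
  finally show ?thesis using fk \<mu>(2) by simp
qed

text \<open>A Harnack inequality: along an edge from j to l, subinvariance gives q j l * u j \<le>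
  \<rho> * u l, and these bounds multiply along the path. The constant is chosen before
  \<open>u\<close> and \<rho>, which is what a limit over varying \<open>u\<close> requires.\<close>

lemma left_subinvariant_chain:
  fixes q :: "nat \<Rightarrow> nat \<Rightarrow> real" and b :: real
  assumes q: "\<And>k l. k < n \<Longrightarrow> l < n \<Longrightarrow> 0 \<le> q k l"
    and path: "(k, l) \<in> {(k, l). k < n \<and> l < n \<and> 0 < q k l}\<^sup>*"
  shows "\<exists>c>0. \<forall>u \<rho>. (\<forall>k<n. 0 < u k) \<and> (\<forall>l<n. (\<Sum>k<n. u k * q k l) \<le> \<rho> * u l) \<and>
    0 < \<rho> \<and> \<rho> \<le> b \<longrightarrow> c * u k \<le> u l" (is "\<exists>c>0. \<forall>u \<rho>. ?P u \<rho> \<longrightarrow> _")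
  using path
proof (induction rule: rtrancl_induct)
  case base
  show ?case by (intro exI[of _ 1]) auto
next
  case (step j l)
  then obtain c where c: "c > 0" "\<And>u \<rho>. ?P u \<rho> \<Longrightarrow> c * u k \<le> u j" by blast
  from step have jl: "j < n" "l < n" "0 < q j l" by auto
  \<comment> \<open>\<open>max b 1\<close> bounds \<rho> and is positive whatever the sign of
    \<open>b\<close>.\<close>
  have "c * q j l / max b 1 * u k \<le> u l" if P: "?P u \<rho>" for u \<rho>
  proof -
    have u: "0 \<le> u i" if "i < n" for i using P that less_imp_le by blast
    have "c * q j l * u k \<le> u j * q j l" using c(2)[OF P] jl(3) by (simp add: ac_simps)
    also have "\<dots> \<le> (\<Sum>k<n. u k * q k l)"
      using u q jl by (intro member_le_sum[where f = "\<lambda>k. u k * q k l"]) auto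
    also have "\<dots> \<le> \<rho> * u l" using P jl by auto
    also have "\<dots> \<le> max b 1 * u l" using P u jl by (intro mult_right_mono) auto
    finally show ?thesis by (simp add: field_simps)
  qed
  then show ?case using c(1) jl(3) by (intro exI[of _ "c * q j l / max b 1"]) auto
qed

text \<open>Wielandt's comparison theorem in its strict form. With \<open>\<rho> = spr M \<ge> spr q\<close> and \<open>g\<close> the
  modulus of an eigenvector, \<open>\<rho> g \<le> |M| g \<le> q g\<close>; pairing with almost invariant left vectors of
  \<open>q\<close>, whose ratios stay bounded by irreducibility, forces equality throughout.\<close>

theorem spectral_radius_strict_mono:
  assumes "0 < n" and M: "M \<in> carrier_mat n n"
    and le: "\<And>k l. k < n \<Longrightarrow> l < n \<Longrightarrow> cmod (M $$ (k, l)) \<le> q k l"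
    and irr: "\<And>k l. k < n \<Longrightarrow> l < n \<Longrightarrow> (k, l) \<in> {(k, l). k < n \<and> l < n \<and> 0 < q k l}\<^sup>*"
    and ab: "a < n" "b < n" "cmod (M $$ (a, b)) < q a b"
  shows "spectral_radius M < spectral_radius (cmat n q)"
proof (rule ccontr)
  assume "\<not> ?thesis"
  then have ge: "spectral_radius (cmat n q) \<le> spectral_radius M" by simp
  define \<rho> where "\<rho> = spectral_radius M"
  have q: "0 \<le> q k l" if "k < n" "l < n" for k l
    using le[OF that] norm_ge_zero order_trans by blast
  obtain \<mu> where \<mu>: "eigenvalue M \<mu>" "cmod \<mu> = \<rho>"
    using spectral_radius_eigenvalue[OF M assms(1)] unfolding \<rho>_def .
  then obtain f where f: "\<exists>k<n. f k \<noteq> 0"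
    "\<And>k. k < n \<Longrightarrow> (\<Sum>l<n. M $$ (k, l) * f l) = \<mu> * f k"
    unfolding eigenvalue_coords[OF M] by auto
  define g where "g k = cmod (f k)" for k
  have g0: "0 \<le> g k" for k by (simp add: g_def)
  have \<rho>0: "0 \<le> \<rho>" using \<mu>(2) norm_ge_zero by metis
  have 1: "\<rho> * g k \<le> (\<Sum>l<n. cmod (M $$ (k, l)) * g l)" if "k < n" for k
  proof -
    have "\<rho> * g k = cmod (\<Sum>l<n. M $$ (k, l) * f l)"
      using f(2)[OF that] by (simp add: g_def norm_mult \<mu>(2))
    also have "\<dots> \<le> (\<Sum>l<n. cmod (M $$ (k, l)) * g l)"
      by (intro order_trans[OF norm_sum] sum_mono) (auto simp: norm_mult g_def)
    finally show ?thesis .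
  qed
  have 2: "cmod (M $$ (k, l)) * g l \<le> q k l * g l" if "k < n" "l < n" for k l
    using le[OF that] g0 by (intro mult_right_mono)
  define d where "d k = (\<Sum>l<n. q k l * g l) - \<rho> * g k" for k
  have d0: "0 \<le> d k" if "k < n" for k
    using 1[OF that] sum_mono[of "{..<n}" "\<lambda>l. cmod (M $$ (k, l)) * g l" "\<lambda>l. q k l * g l"] 2 that
    by (auto simp: d_def)
  have d: "d k = 0" if k: "k < n" for k
  proof -
    define S where "S u t \<longleftrightarrow> (\<forall>k<n. 0 < u k) \<and> (\<forall>l<n. (\<Sum>k<n. u k * q k l) \<le> t * u l) \<and>
      0 < t \<and> t \<le> \<rho> + 1" for u :: "nat \<Rightarrow> real" and t
    \<comment> \<open>The Harnack constants are fixed before \<epsilon>; the vectors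
      \<open>u\<close> below change with \<epsilon>.\<close>
    have "\<exists>c>0. \<forall>u t. S u t \<longrightarrow> c * u j \<le> u k" if "j < n" for j
      unfolding S_def by (rule left_subinvariant_chain[OF _ irr[OF that k]]) (rule q)
    then obtain c where c: "\<And>j. j < n \<Longrightarrow> 0 < c j"
      "\<And>j u t. j < n \<Longrightarrow> S u t \<Longrightarrow> c j * u j \<le> u k" by metis
    have bd: "d k \<le> \<epsilon> * (\<Sum>j<n. g j / c j)" if \<epsilon>: "0 < \<epsilon>" "\<epsilon> \<le> 1" for \<epsilon>
    proof -
      have "spectral_radius (cmat n q) < \<rho> + \<epsilon>" using ge \<epsilon> by (simp add: \<rho>_def)
      then obtain u where u: "\<And>k. k < n \<Longrightarrow> 0 < u k"
        "\<And>l. l < n \<Longrightarrow> (\<Sum>k<n. u k * q k l) \<le> (\<rho> + \<epsilon>) * u l"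
        using left_subinvariant[of n q "\<rho> + \<epsilon>"] assms(1) q by blast
      have S: "S u (\<rho> + \<epsilon>)" using u \<epsilon> \<rho>0 by (simp add: S_def)
      have cu: "u j \<le> u k / c j" if "j < n" for j
        using c(2)[OF that S] c(1)[OF that] by (simp add: pos_le_divide_eq mult.commute)
      \<comment> \<open>The defect d = q g - \<rho> g is nonnegative. Its pairing with
        \<open>u\<close> is at most \<epsilon> times the pairing of \<open>u\<close> with
        \<open>g\<close>, since u q \<le> (\<rho> + \<epsilon>) u.\<close>
      have "u k * d k \<le> (\<Sum>i<n. u i * d i)"
        using k d0 u(1)[THEN less_imp_le] by (intro member_le_sum[where f = "\<lambda>k. u k * d k"]) auto
      also have "\<dots> = (\<Sum>i<n. \<Sum>l<n. u i * q i l * g l) - (\<Sum>i<n. \<rho> * u i * g i)"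
        by (simp add: d_def right_diff_distrib sum_subtractf sum_distrib_left ac_simps)
      also have "(\<Sum>i<n. \<Sum>l<n. u i * q i l * g l) = (\<Sum>l<n. (\<Sum>i<n. u i * q i l) * g l)"
        by (subst sum.swap) (simp add: sum_distrib_right)
      also have "\<dots> \<le> (\<Sum>l<n. (\<rho> + \<epsilon>) * u l * g l)"
        using u(2) g0 by (intro sum_mono mult_right_mono) auto
      also have "\<dots> - (\<Sum>i<n. \<rho> * u i * g i) = \<epsilon> * (\<Sum>l<n. u l * g l)"
        by (simp add: sum_distrib_left sum_subtractf[symmetric] algebra_simps)
      also have "\<dots> \<le> \<epsilon> * (\<Sum>l<n. u k / c l * g l)"
        using cu g0 \<epsilon> by (intro mult_left_mono sum_mono mult_right_mono) auto
      also have "\<dots> = u k * (\<epsilon> * (\<Sum>l<n. g l / c l))"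
        by (simp add: sum_distrib_left ac_simps)
      finally show ?thesis using u(1)[OF k] by simp
    qed
    show ?thesis
    proof (rule ccontr)
      assume "d k \<noteq> 0"
      then have dk: "0 < d k" using d0[OF k] by simp
      define s where "s = (\<Sum>j<n. g j / c j)"
      have "0 \<le> s" unfolding s_def using g0 c(1) by (intro sum_nonneg divide_nonneg_pos) auto
      \<comment> \<open>Small enough that \<epsilon> * s < d k, contradicting \<open>bd\<close>; the
        minimum with 1 keeps \<rho> + \<epsilon> in the range covered by the Harnack
        constants.\<close>
      define \<epsilon> where "\<epsilon> = min 1 (d k / (2 * (s + 1)))"
      have "0 < \<epsilon>" "\<epsilon> \<le> 1" using dk \<open>0 \<le> s\<close> by (auto simp: \<epsilon>_def)
      from bd[OF this] have "d k \<le> \<epsilon> * s" by (simp add: s_def)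
      also have "\<dots> \<le> d k / (2 * (s + 1)) * s"
        using \<open>0 \<le> s\<close> by (intro mult_right_mono) (auto simp: \<epsilon>_def)
      also have "\<dots> = d k * (s / (2 * (s + 1)))" by simp
      also have "\<dots> < d k * 1" using dk \<open>0 \<le> s\<close> by (intro mult_strict_left_mono) auto
      finally show False by simp
    qed
  qed
  \<comment> \<open>With zero defect, row \<open>a\<close> satisfies |M| g = q g; a strictly smaller
    entry at \<open>b\<close> is possible only if \<open>g\<close> vanishes there.\<close>
  have "g b = 0"
  proof -
    have "(\<Sum>l<n. q a l * g l - cmod (M $$ (a, l)) * g l) \<le> 0"
      using 1[OF ab(1)] d[OF ab(1)] by (simp add: sum_subtractf d_def)
    moreover have "q a b * g b - cmod (M $$ (a, b)) * g b
        \<le> (\<Sum>l<n. q a l * g l - cmod (M $$ (a, l)) * g l)"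
      using 2 ab by (intro member_le_sum[where f = "\<lambda>l. q a l * g l - cmod (M $$ (a, l)) * g l"]) auto
    ultimately have "(q a b - cmod (M $$ (a, b))) * g b \<le> 0" by (simp add: left_diff_distrib)
    then show ?thesis using ab(3) g0[of b] by (simp add: mult_le_0_iff)
  qed
  \<comment> \<open>From q g = \<rho> g, a zero of \<open>g\<close> at i forces zeros at all
    successors of i, and every index is reachable from \<open>b\<close>.\<close>
  have "g l = 0" if "l < n" for l
    using irr[OF ab(2) that]
  proof (induction rule: rtrancl_induct)
    case (step i j)
    then have ij: "i < n" "j < n" "0 < q i j" by auto
    have "q i j * g j \<le> (\<Sum>l<n. q i l * g l)"
      using ij q g0 by (intro member_le_sum) auto
    also have "\<dots> = 0" using d[OF ij(1)] step by (simp add: d_def)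
    finally show ?case using ij(3) g0[of j] by (simp add: mult_le_0_iff)
  qed (rule \<open>g b = 0\<close>)
  then show False using f(1) by (auto simp: g_def)
qed

section \<open>Complex weights dominated by real ones\<close>

text \<open>The situation when \<open>c\<close> is a sum of complex terms whose moduli are bounded by terms with
  sum \<open>q\<close>, and some nonzero term attains its bound and has phase \<open>t\<close>: equality in the triangle
  inequality forces all terms to have this phase.\<close>

definition aligned :: "complex \<Rightarrow> real \<Rightarrow> complex \<Rightarrow> bool" where
  "aligned c q t \<longleftrightarrow> 0 < q \<and> cmod c \<le> q \<and> (cmod c = q \<longrightarrow> c = of_real q * t)"

lemma aligned_pos: "aligned c q t \<Longrightarrow> 0 < q"
  by (simp add: aligned_def)

lemma aligned_one: "aligned 1 1 t \<longleftrightarrow> t = 1"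
  by (auto simp: aligned_def)

lemma aligned_of_real_mult:
  assumes "0 < q" "cmod t = 1"
  shows "aligned (of_real q * t) q t"
  using assms by (simp add: aligned_def norm_mult)

lemma aligned_mult:
  assumes "aligned c q t" "aligned c' q' t'"
  shows "aligned (c * c') (q * q') (t * t')"
proof -
  have q: "0 < q" "0 < q'" "cmod c \<le> q" "cmod c' \<le> q'" using assms by (auto simp: aligned_def)
  have "cmod c = q \<and> cmod c' = q'" if "cmod c * cmod c' = q * q'"
  proof -
    have "q * cmod c' \<le> q * q'" "cmod c * q' \<le> q * q'" "cmod c * cmod c' \<le> q * cmod c'"
      "cmod c * cmod c' \<le> cmod c * q'"
      using q by (auto intro!: mult_left_mono mult_right_mono)
    then have "q * cmod c' = q * q'" "cmod c * q' = q * q'" using that by linarith+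
    then show ?thesis using q by simp
  qed
  then show ?thesis using assms q
    by (auto simp: aligned_def norm_mult intro!: mult_mono)
qed

text \<open>The equality case of the triangle inequality: if the sum attains its bound, both
  summands attain theirs and \<open>d\<close> has the direction of \<open>c\<close>.\<close>

lemma aligned_add:
  assumes "aligned c q t" "cmod d \<le> p"
  shows "aligned (c + d) (q + p) t"
proof -
  have q: "0 < q" "cmod c \<le> q" using assms by (auto simp: aligned_def)
  have p: "0 \<le> p" using assms(2) norm_ge_zero order_trans by blast
  have "c + d = of_real (q + p) * t" if eq: "cmod (c + d) = q + p"
  proof -
    have c: "cmod c = q" "cmod d = p" "norm (c + d) = norm c + norm d"
      using eq norm_triangle_ineq[of c d] q(2) assms(2) by linarith+
    then have ct: "c = of_real q * t" using assms(1) by (simp add: aligned_def)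
    have "of_real q * d = of_real p * c"
      using c norm_triangle_eq[of c d] by (simp add: scaleR_conv_of_real)
    then have "of_real q * d = of_real q * (of_real p * t)" by (simp add: ct)
    then have "d = of_real p * t" using q(1) by (subst (asm) mult_left_cancel) auto
    then show ?thesis by (simp add: ct ring_distribs)
  qed
  then show ?thesis
    using q p assms(2) norm_triangle_ineq[of c d] by (auto simp: aligned_def)
qed

lemma aligned_add':
  assumes "aligned c q t" "cmod d \<le> p"
  shows "aligned (d + c) (p + q) t"
  using aligned_add[OF assms] by (simp add: add.commute)

lemma aligned_sum:
  assumes "finite I" "i \<in> I" "aligned (c i) (q i) t" "\<And>j. j \<in> I \<Longrightarrow> cmod (c j) \<le> q j"
  shows "aligned (\<Sum>j\<in>I. c j) (\<Sum>j\<in>I. q j) t"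
proof -
  have "cmod (\<Sum>j\<in>I - {i}. c j) \<le> (\<Sum>j\<in>I - {i}. q j)"
    using assms(4) by (intro sum_norm_le) auto
  from aligned_add[OF assms(3) this] show ?thesis
    using assms(1,2) by (simp add: sum.remove)
qed

lemma aligned_suminf:
  assumes "summable q" "aligned (c m) (q m) t" "\<And>n. cmod (c n) \<le> q n"
  shows "aligned (\<Sum>n. c n) (\<Sum>n. q n) t"
proof -
  have sc: "summable c" by (rule summable_comparison_test'[OF assms(1)]) (use assms(3) in auto)
  \<comment> \<open>Taking out the single term of index m reduces the series to a sum of two
    numbers, the second one merely dominated.\<close>
  have split: "summable (f(m := 0)) \<and> suminf f = f m + suminf (f(m := 0))"
    if "summable f" for f :: "nat \<Rightarrow> 'a::real_normed_vector"
  proof -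
    have "(\<lambda>n. f n - (if n = m then f n else 0)) sums (suminf f - f m)"
      by (intro sums_diff summable_sums that sums_If_finite_set[of "{m}", simplified])
    moreover have "(\<lambda>n. f n - (if n = m then f n else 0)) = f(m := 0)" by auto
    ultimately have "f(m := 0) sums (suminf f - f m)" by simp
    then show ?thesis by (auto simp: sums_iff)
  qed
  have "cmod (suminf (c(m := 0))) \<le> suminf (q(m := 0))"
    using split[OF assms(1)] assms(3) by (intro norm_suminf_le) auto
  from aligned_add[OF assms(2) this] show ?thesis
    using split[OF assms(1)] split[OF sc] by simp
qed

text \<open>The source of strictness: a number attaining its bound has only one phase.\<close>

lemma aligned_distinct_strict:
  assumes "aligned c q t" "aligned c q t'" "t \<noteq> t'"
  shows "cmod c < q"
proof -
  have "cmod c \<noteq> q"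
  proof
    assume "cmod c = q"
    then have "of_real q * t = of_real q * t'"
      using assms(1,2) unfolding aligned_def by metis
    then show False using assms(3) aligned_pos[OF assms(1)] by simp
  qed
  then show ?thesis using assms(1) by (simp add: aligned_def)
qed

section \<open>Weights of paths of levels\<close>

text \<open>The entries of A_{*,j}(r) for real r, kept real so that they can serve as bounds for the
  complex entries on the circle of radius r.\<close>

definition level_weight :: "(int \<Rightarrow> int \<Rightarrow> real mat) \<Rightarrow> real \<Rightarrow> int \<Rightarrow> nat \<Rightarrow> nat \<Rightarrow> real" where
  "level_weight A r j k l = (\<Sum>i\<in>H. A i j $$ (k, l) * r powi i)"

primrec path_weight :: "nat \<Rightarrow> (int \<Rightarrow> int \<Rightarrow> real mat) \<Rightarrow> real \<Rightarrow> int list \<Rightarrow> nat \<Rightarrow> nat \<Rightarrow> real" where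
  "path_weight s0 A r [] k l = (if k = l then 1 else 0)"
| "path_weight s0 A r (j # js) k l = (\<Sum>m<s0. level_weight A r j k m * path_weight s0 A r js m l)"

text \<open>The jump sequences that start at height \<open>h\<close> and reach height 0 for the
  first time at their end. The recursion suits inductions that let the starting height vary.\<close>

primrec descent :: "int \<Rightarrow> int list \<Rightarrow> bool" where
  "descent h [] \<longleftrightarrow> h = 0"
| "descent h (j # js) \<longleftrightarrow> 1 \<le> h \<and> j \<in> H \<and> descent (h + j) js"

lemma descent_iff:
  "descent h js \<longleftrightarrow> set js \<subseteq> H \<and> h + sum_list js = 0 \<and>
    (\<forall>k<length js. 1 \<le> h + sum_list (take k js))"
  by (induction js arbitrary: h) (auto simp: All_less_Suc2 add.assoc)

lemma descent_subset: "descent h js \<Longrightarrow> set js \<subseteq> H"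
  by (simp add: descent_iff)

text \<open>Starting at height 1 turns partial sums \<ge> 0 into heights \<ge> 1. The additional
  index k = 0 on the right imposes nothing, as the empty sum is 0.\<close>

lemma first_passage_Suc: "first_passage (Suc n) = {js. length js = Suc n \<and> descent 1 js}"
proof -
  have *: "(\<forall>k\<in>{1..n}. P k) \<longleftrightarrow> (\<forall>k<Suc n. P k)" if "P 0" for P
    using that by (metis One_nat_def Suc_leI atLeastAtMost_iff gr0I less_Suc_eq_le)
  have "(\<forall>k\<in>{1..Suc n - 1}. 0 \<le> sum_list (take k js)) \<longleftrightarrow>
      (\<forall>k<Suc n. 0 \<le> sum_list (take k js))" for js :: "int list"
    using *[of "\<lambda>k. 0 \<le> sum_list (take k js)"] by simp
  then show ?thesis unfolding first_passage_def descent_iff by auto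
qed

lemma finite_H: "finite H" by (simp add: H_def)

lemma finite_first_passage: "finite (first_passage n)"
  by (rule finite_subset[OF _ finite_lists_length_eq[OF finite_H, of n]])
    (auto simp: first_passage_def)

section \<open>Entries of matrix products along paths, their bounds and their phases\<close>

lemma Astar_of_real:
  "k < s0 \<Longrightarrow> l < s0 \<Longrightarrow> Astar s0 A j (of_real r) $$ (k, l) = of_real (level_weight A r j k l)"
  by (simp add: Astar_def level_weight_def)

lemma Astar_carrier: "Astar s0 A j z \<in> carrier_mat s0 s0"
  by (simp add: Astar_def)

lemma path_prod_carrier: "path_prod s0 A z js \<in> carrier_mat s0 s0"
  using Astar_carrier by (induction js) (auto simp: path_prod_def intro!: mult_carrier_mat)

lemma path_prod_Nil: "k < s0 \<Longrightarrow> l < s0 \<Longrightarrow> path_prod s0 A z [] $$ (k, l) = (if k = l then 1 else 0)"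
  by (simp add: path_prod_def)

lemma index_mult_mat_sum:
  assumes "X \<in> carrier_mat n n" "Y \<in> carrier_mat n n" "k < n" "l < n"
  shows "(X * Y) $$ (k, l) = (\<Sum>m<n. X $$ (k, m) * Y $$ (m, l))"
  using assms by (auto simp: scalar_prod_def lessThan_atLeast0 intro!: sum.cong)

lemma path_prod_Cons:
  "k < s0 \<Longrightarrow> l < s0 \<Longrightarrow> path_prod s0 A z (j # js) $$ (k, l) =
    (\<Sum>m<s0. Astar s0 A j z $$ (k, m) * path_prod s0 A z js $$ (m, l))"
  using index_mult_mat_sum[OF Astar_carrier path_prod_carrier, of k s0 l A j z A z js]
  by (simp add: path_prod_def)

lemma path_prod_of_real:
  "k < s0 \<Longrightarrow> l < s0 \<Longrightarrow> path_prod s0 A (of_real r) js $$ (k, l) = of_real (path_weight s0 A r js k l)"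
  by (induction js arbitrary: k) (simp_all add: path_prod_Nil path_prod_Cons Astar_of_real)

lemma level_weight_nonneg:
  assumes "nonneg_blocks s0 H J A" "j \<in> J" "k < s0" "l < s0" "0 \<le> r"
  shows "0 \<le> level_weight A r j k l"
  using assms by (auto simp: level_weight_def nonneg_blocks_def intro!: sum_nonneg mult_nonneg_nonneg)

lemma norm_Astar_le:
  assumes "nonneg_blocks s0 H J A" "j \<in> J" "k < s0" "l < s0"
  shows "cmod (Astar s0 A j z $$ (k, l)) \<le> level_weight A (cmod z) j k l"
  using assms unfolding Astar_def level_weight_def
  by (auto simp: nonneg_blocks_def norm_mult norm_power_int intro!: sum_norm_le)

lemma powi_sgn: "z powi i = of_real (cmod z powi i) * sgn z powi i" for z :: complex
proof -
  have "z = of_real (cmod z) * sgn z" by (simp add: sgn_eq)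
  then have "z powi i = (of_real (cmod z) * sgn z) powi i" by simp
  then show ?thesis by (simp add: power_int_mult_distrib)
qed

lemma norm_sgn_powi: "z \<noteq> 0 \<Longrightarrow> cmod (sgn z powi i) = 1"
  by (simp add: norm_power_int norm_sgn)

text \<open>The summand with horizontal jump i is nonzero, attains its bound and has phase (sgn
  z)^i; the other summands are only dominated.\<close>

lemma aligned_Astar:
  assumes "nonneg_blocks s0 H J A" "j \<in> J" "i \<in> H" "k < s0" "l < s0" "0 < A i j $$ (k, l)" "z \<noteq> 0"
  shows "aligned (Astar s0 A j z $$ (k, l)) (level_weight A (cmod z) j k l) (sgn z powi i)"
proof -
  have "aligned (of_real (A i j $$ (k, l)) * z powi i) (A i j $$ (k, l) * cmod z powi i) (sgn z powi i)"
    using aligned_of_real_mult[of "A i j $$ (k, l) * cmod z powi i" "sgn z powi i"] assms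
    by (simp add: powi_sgn[of z i] norm_sgn_powi mult.assoc)
  then have "aligned (\<Sum>i\<in>H. of_real (A i j $$ (k, l)) * z powi i)
      (\<Sum>i\<in>H. A i j $$ (k, l) * cmod z powi i) (sgn z powi i)"
    using assms by (intro aligned_sum[where i = i] finite_H)
      (auto simp: norm_mult norm_power_int nonneg_blocks_def)
  then show ?thesis using assms by (simp add: Astar_def level_weight_def)
qed

lemma path_weight_nonneg:
  assumes "nonneg_blocks s0 H H A" "set js \<subseteq> H" "k < s0" "l < s0" "0 \<le> r"
  shows "0 \<le> path_weight s0 A r js k l"
  using assms by (induction js arbitrary: k) (auto intro!: sum_nonneg mult_nonneg_nonneg level_weight_nonneg)

lemma norm_path_prod_le:
  assumes "nonneg_blocks s0 H H A" "set js \<subseteq> H" "k < s0" "l < s0"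
  shows "cmod (path_prod s0 A z js $$ (k, l)) \<le> path_weight s0 A (cmod z) js k l"
  using assms
proof (induction js arbitrary: k)
  case (Cons j js)
  then show ?case
    by (auto simp: path_prod_Cons norm_mult intro!: sum_norm_le mult_mono norm_Astar_le level_weight_nonneg)
qed (simp add: path_prod_Nil)

text \<open>The summand through the intermediate phase \<open>m\<close> is a product of aligned
  factors, so their phases multiply: horizontal displacements add in the exponent of sgn z.\<close>

lemma aligned_path_prod_Cons:
  assumes "nonneg_blocks s0 H H A" "j \<in> H" "set js \<subseteq> H" "i \<in> H" "k < s0" "m < s0" "l < s0"
    "0 < A i j $$ (k, m)" "z \<noteq> 0"
    "aligned (path_prod s0 A z js $$ (m, l)) (path_weight s0 A (cmod z) js m l) (sgn z powi d)"
  shows "aligned (path_prod s0 A z (j # js) $$ (k, l)) (path_weight s0 A (cmod z) (j # js) k l)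
    (sgn z powi (i + d))"
proof -
  have "aligned (Astar s0 A j z $$ (k, m) * path_prod s0 A z js $$ (m, l))
     (level_weight A (cmod z) j k m * path_weight s0 A (cmod z) js m l) (sgn z powi (i + d))"
    using assms by (subst power_int_add) (auto intro!: aligned_mult aligned_Astar simp: sgn_zero_iff)
  then have "aligned (\<Sum>m<s0. Astar s0 A j z $$ (k, m) * path_prod s0 A z js $$ (m, l))
      (\<Sum>m<s0. level_weight A (cmod z) j k m * path_weight s0 A (cmod z) js m l) (sgn z powi (i + d))"
    using assms by (intro aligned_sum[where i = m])
      (auto simp: norm_mult intro!: mult_mono norm_Astar_le norm_path_prod_le level_weight_nonneg)
  then show ?thesis using assms by (simp add: path_prod_Cons)
qed

section \<open>Paths of Markov chains\<close>

text \<open>Irreducibility is exploited only through paths of positive transitions, so the chains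
  are reduced to this relation.\<close>

definition steps :: "'s set \<Rightarrow> ('s \<Rightarrow> 's \<Rightarrow> real) \<Rightarrow> ('s \<times> 's) set" where
  "steps S P = {(x, y). x \<in> S \<and> y \<in> S \<and> 0 < P x y}"

lemma nstep_nonneg:
  assumes "\<And>x y. x \<in> S \<Longrightarrow> y \<in> S \<Longrightarrow> 0 \<le> P x y" "x \<in> S" "y \<in> S"
  shows "0 \<le> nstep S P n x y"
  using assms(2) by (induction n arbitrary: x) (auto intro!: infsum_nonneg mult_nonneg_nonneg assms)

lemma nstep_pos_relpow:
  assumes P: "\<And>x y. x \<in> S \<Longrightarrow> y \<in> S \<Longrightarrow> 0 \<le> P x y" and "x \<in> S" "y \<in> S" "0 < nstep S P n x y"
  shows "(x, y) \<in> steps S P ^^ n"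
  using assms(2,4)
proof (induction n arbitrary: x)
  case 0
  then show ?case by (auto split: if_splits)
next
  case (Suc n)
  \<comment> \<open>No summability enters: an infinite sum whose terms all vanish is 0, so a
    positive value exhibits a nonzero term.\<close>
  have "\<exists>u\<in>S. P x u * nstep S P n u y \<noteq> 0"
    using Suc.prems(2) infsum_0[of S "\<lambda>u. P x u * nstep S P n u y"] by force
  then obtain u where u: "u \<in> S" "P x u * nstep S P n u y \<noteq> 0" by blast
  then have "0 < P x u" "0 < nstep S P n u y"
    using P[OF Suc.prems(1) u(1)] nstep_nonneg[of S P u y n] P assms(3) by (auto simp: less_le)
  then show ?case using Suc u(1) by (intro relpow_Suc_I2[of x u]) (auto simp: steps_def)
qed

lemma irreducible_chain_path:
  assumes "irreducible_chain S P" "\<And>x y. x \<in> S \<Longrightarrow> y \<in> S \<Longrightarrow> 0 \<le> P x y" "x \<in> S" "y \<in> S"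
  obtains n where "(x, y) \<in> steps S P ^^ n"
  using assms nstep_pos_relpow unfolding irreducible_chain_def by metis

lemma trans0_nonneg:
  assumes "nonneg_blocks s0 H H A" "x \<in> states0 s0" "y \<in> states0 s0"
  shows "0 \<le> trans0 A x y"
  using assms by (auto simp: trans0_def jump_def nonneg_blocks_def states0_def)

lemma trans1_nonneg:
  assumes "nonneg_blocks s0 H H A" "nonneg_blocks s0 H Hplus A1" "x \<in> states1 s0" "y \<in> states1 s0"
  shows "0 \<le> trans1 A A1 x y"
  using assms by (auto simp: trans1_def jump_def nonneg_blocks_def states1_def)

lemma steps_trans0:
  "((x, h, k), (x', h', k')) \<in> steps (states0 s0) (trans0 A) \<longleftrightarrow>
    k < s0 \<and> k' < s0 \<and> x' - x \<in> H \<and> h' - h \<in> H \<and> 0 < A (x' - x) (h' - h) $$ (k, k')"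
  by (auto simp: steps_def states0_def trans0_def jump_def split: if_splits)

lemma steps_trans1:
  assumes "((x, h, k), (x', h', k')) \<in> steps (states1 s0) (trans1 A A1)"
  shows "k < s0" "k' < s0" "0 \<le> h" "0 \<le> h'" "x' - x \<in> H"
    "1 \<le> h \<Longrightarrow> h' - h \<in> H \<and> 0 < A (x' - x) (h' - h) $$ (k, k')"
    "h = 0 \<Longrightarrow> h' \<in> Hplus \<and> 0 < A1 (x' - x) h' $$ (k, k')"
  using assms
  by (auto simp: steps_def states1_def trans1_def jump_def split: if_splits)

lemmas rtrancl_induct3 = rtrancl_induct[of "(ax, ay, az)" "(bx, by, bz)",
  split_format (complete), consumes 1, case_names refl step]

lemmas converse_rtrancl_induct3 = converse_rtrancl_induct[of "(ax, ay, az)" "(bx, by, bz)",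
  split_format (complete), consumes 1, case_names refl step]

section \<open>Convergence of the first passage series\<close>

text \<open>This says C(e^s1, e^s2) e^u \<le> e^\<eta> e^u entrywise, divided by e^u. In logarithmic
  coordinates each term is a nonnegative multiple of the exponential of a linear form in (s1, s2,
  u), so convexity can be used.\<close>

definition subinvariant ::
  "nat \<Rightarrow> (int \<Rightarrow> int \<Rightarrow> real mat) \<Rightarrow> real \<Rightarrow> real \<Rightarrow> real \<Rightarrow> (nat \<Rightarrow> real) \<Rightarrow> bool" where
  "subinvariant s0 A \<eta> s1 s2 u \<longleftrightarrow> (\<forall>k<s0. (\<Sum>i\<in>H. \<Sum>j\<in>H. \<Sum>m<s0.
     A i j $$ (k, m) * exp (of_int i * s1 + of_int j * s2 + u m - u k)) \<le> exp \<eta>)"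

lemma sum_rotate:
  "(\<Sum>i\<in>I. \<Sum>j\<in>J. \<Sum>m\<in>K. f i j m) = (\<Sum>m\<in>K. \<Sum>i\<in>I. \<Sum>j\<in>J. f i j m)"
  for f :: "'a \<Rightarrow> 'b \<Rightarrow> 'c \<Rightarrow> 'd :: comm_monoid_add"
proof -
  have "(\<Sum>i\<in>I. \<Sum>j\<in>J. \<Sum>m\<in>K. f i j m) = (\<Sum>i\<in>I. \<Sum>m\<in>K. \<Sum>j\<in>J. f i j m)"
    by (intro sum.cong refl sum.swap)
  also have "\<dots> = (\<Sum>m\<in>K. \<Sum>i\<in>I. \<Sum>j\<in>J. f i j m)" by (rule sum.swap)
  finally show ?thesis .
qed

lemma C_exp:
  "C s0 A (of_real (exp s1)) (of_real (exp s2)) =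
    cmat s0 (\<lambda>k l. \<Sum>i\<in>H. \<Sum>j\<in>H. A i j $$ (k, l) * exp (of_int i * s1 + of_int j * s2))"
proof -
  have "complex_of_real (exp s) powi i = of_real (exp (of_int i * s))" for s i
    by (simp only: exp_power_int[symmetric] of_real_power_int)
  then show ?thesis
    by (intro eq_matI) (simp_all only: C_def exp_add mult.assoc dim_row_mat dim_col_mat index_mat
      case_prod_conv of_real_sum of_real_mult)
qed

lemma sum_H_nonneg:
  assumes "nonneg_blocks s0 H H A" "k < s0" "l < s0"
  shows "0 \<le> (\<Sum>i\<in>H. \<Sum>j\<in>H. A i j $$ (k, l) * exp (f i j))"
  using assms by (auto simp: nonneg_blocks_def intro!: sum_nonneg)

text \<open>The slack \<eta> turns spectral radius \<le> 1 into the strict bound < exp \<eta> under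
  which a positive subinvariant vector v exists; then u = ln v.\<close>

lemma Gamma_region_subinvariant:
  assumes "0 < s0" "nonneg_blocks s0 H H A" "(s1, s2) \<in> Gamma_region s0 A" "0 < \<eta>"
  obtains u where "subinvariant s0 A \<eta> s1 s2 u"
proof -
  define q where "q k l = (\<Sum>i\<in>H. \<Sum>j\<in>H. A i j $$ (k, l) * exp (of_int i * s1 + of_int j * s2))"
    for k l
  have "spectral_radius (cmat s0 q) \<le> 1"
    using assms(3) unfolding Gamma_region_def C_exp q_def by simp
  also have "1 < exp \<eta>" using assms(4) by simp
  finally have "spectral_radius (cmat s0 q) < exp \<eta>" .
  moreover have "0 \<le> q k l" if "k < s0" "l < s0" for k l
    unfolding q_def by (rule sum_H_nonneg[OF assms(2) that])
  ultimately obtain v where v: "\<And>k. k < s0 \<Longrightarrow> 0 < v k"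
    "\<And>k. k < s0 \<Longrightarrow> (\<Sum>l<s0. q k l * v l) \<le> exp \<eta> * v k"
    using right_subinvariant[of s0 q "exp \<eta>"] assms(1) by blast
  have "subinvariant s0 A \<eta> s1 s2 (\<lambda>k. ln (v k))"
    unfolding subinvariant_def
  proof (intro allI impI)
    fix k assume k: "k < s0"
    have "(\<Sum>i\<in>H. \<Sum>j\<in>H. \<Sum>m<s0.
        A i j $$ (k, m) * exp (of_int i * s1 + of_int j * s2 + ln (v m) - ln (v k)))
      = (\<Sum>i\<in>H. \<Sum>j\<in>H. \<Sum>m<s0.
        A i j $$ (k, m) * exp (of_int i * s1 + of_int j * s2) * v m / v k)"
      using v(1) k by (intro sum.cong refl) (simp add: exp_add exp_diff)
    also have "\<dots> = (\<Sum>m<s0. q k m * v m) / v k"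
      by (subst sum_rotate) (simp only: q_def sum_divide_distrib sum_distrib_right)
    also have "\<dots> \<le> exp \<eta>" using v k by (simp add: pos_divide_le_eq)
    finally show "(\<Sum>i\<in>H. \<Sum>j\<in>H. \<Sum>m<s0.
      A i j $$ (k, m) * exp (of_int i * s1 + of_int j * s2 + ln (v m) - ln (v k))) \<le> exp \<eta>" .
  qed
  then show thesis by (rule that)
qed

text \<open>Row sums equal to 1 make the constant vector invariant.\<close>

lemma zero_in_Gamma_region:
  assumes "0 < s0" "nonneg_blocks s0 H H A" "stochastic_mat s0 (block_sum s0 H H A)"
  shows "(0, 0) \<in> Gamma_region s0 A"
proof -
  let ?q = "\<lambda>k l. \<Sum>i\<in>H. \<Sum>j\<in>H. A i j $$ (k, l) * exp (of_int i * 0 + of_int j * 0)"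
  have "(\<Sum>l<s0. ?q k l * 1) \<le> 1 * 1" if "k < s0" for k
    using assms(3) that by (simp add: stochastic_mat_def block_sum_def)
  then have "spectral_radius (cmat s0 ?q) \<le> 1"
    by (intro spectral_radius_le[where v = "\<lambda>_. 1"] assms(1) sum_H_nonneg[OF assms(2)]) simp_all
  then show ?thesis by (simp only: Gamma_region_def C_exp mem_Collect_eq case_prod_conv)
qed

text \<open>Convexity of exp, applied term by term, allows interpolation between points of the
  region together with their vectors.\<close>

lemma subinvariant_convex:
  assumes "nonneg_blocks s0 H H A" "subinvariant s0 A \<eta> s1 s2 u" "subinvariant s0 A \<eta> s1' s2' u'"
    "0 \<le> t" "t \<le> 1"
  shows "subinvariant s0 A \<eta> ((1 - t) * s1 + t * s1') ((1 - t) * s2 + t * s2')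
    (\<lambda>k. (1 - t) * u k + t * u' k)"
  unfolding subinvariant_def
proof (intro allI impI)
  fix k assume k: "k < s0"
  let ?e = "\<lambda>i j m. of_int i * s1 + of_int j * s2 + u m - u k"
  let ?e' = "\<lambda>i j m. of_int i * s1' + of_int j * s2' + u' m - u' k"
  have *: "exp (of_int i * ((1 - t) * s1 + t * s1') + of_int j * ((1 - t) * s2 + t * s2') +
      ((1 - t) * u m + t * u' m) - ((1 - t) * u k + t * u' k))
    \<le> (1 - t) * exp (?e i j m) + t * exp (?e' i j m)" for i j m
  proof -
    have "exp ((1 - t) * ?e i j m + t * ?e' i j m) \<le> (1 - t) * exp (?e i j m) + t * exp (?e' i j m)"
      using convex_onD[OF exp_convex assms(4,5), of "?e i j m" "?e' i j m"] by simp
    then show ?thesis by (simp add: algebra_simps)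
  qed
  have "(\<Sum>i\<in>H. \<Sum>j\<in>H. \<Sum>m<s0. A i j $$ (k, m) *
      exp (of_int i * ((1 - t) * s1 + t * s1') + of_int j * ((1 - t) * s2 + t * s2') +
      ((1 - t) * u m + t * u' m) - ((1 - t) * u k + t * u' k)))
    \<le> (\<Sum>i\<in>H. \<Sum>j\<in>H. \<Sum>m<s0. A i j $$ (k, m) * ((1 - t) * exp (?e i j m) + t * exp (?e' i j m)))"
    using assms(1) k by (intro sum_mono mult_left_mono *) (auto simp: nonneg_blocks_def)
  also have "\<dots> = (1 - t) * (\<Sum>i\<in>H. \<Sum>j\<in>H. \<Sum>m<s0. A i j $$ (k, m) * exp (?e i j m))
    + t * (\<Sum>i\<in>H. \<Sum>j\<in>H. \<Sum>m<s0. A i j $$ (k, m) * exp (?e' i j m))"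
    unfolding sum_distrib_left sum.distrib[symmetric]
    by (intro sum.cong refl) (simp only: distrib_left mult.left_commute)
  also have "\<dots> \<le> (1 - t) * exp \<eta> + t * exp \<eta>"
    using assms(2-) k by (intro add_mono mult_left_mono) (auto simp: subinvariant_def)
  also have "\<dots> = exp \<eta>" by (simp add: algebra_simps)
  finally show "(\<Sum>i\<in>H. \<Sum>j\<in>H. \<Sum>m<s0. A i j $$ (k, m) *
      exp (of_int i * ((1 - t) * s1 + t * s1') + of_int j * ((1 - t) * s2 + t * s2') +
      ((1 - t) * u m + t * u' m) - ((1 - t) * u k + t * u' k))) \<le> exp \<eta>" .
qed

text \<open>Horizontal jumps have modulus at most 1, so moving s1 by at most \<delta> multiplies
  each term by at most exp \<delta>.\<close>

lemma subinvariant_shift: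
  assumes "nonneg_blocks s0 H H A" "subinvariant s0 A \<eta> s1 s2 u" "\<bar>s - s1\<bar> \<le> \<delta>"
  shows "subinvariant s0 A (\<delta> + \<eta>) s s2 u"
  unfolding subinvariant_def
proof (intro allI impI)
  fix k assume k: "k < s0"
  have *: "exp (of_int i * s + of_int j * s2 + u m - u k)
    \<le> exp \<delta> * exp (of_int i * s1 + of_int j * s2 + u m - u k)" if "i \<in> H" for i j m
    using that assms(3) by (auto simp: H_def exp_add[symmetric] abs_le_iff)
  have "(\<Sum>i\<in>H. \<Sum>j\<in>H. \<Sum>m<s0. A i j $$ (k, m) * exp (of_int i * s + of_int j * s2 + u m - u k))
    \<le> (\<Sum>i\<in>H. \<Sum>j\<in>H. \<Sum>m<s0. A i j $$ (k, m) *
      (exp \<delta> * exp (of_int i * s1 + of_int j * s2 + u m - u k)))"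
    using assms(1) k by (intro sum_mono mult_left_mono *) (auto simp: nonneg_blocks_def)
  also have "\<dots> = exp \<delta> * (\<Sum>i\<in>H. \<Sum>j\<in>H. \<Sum>m<s0.
      A i j $$ (k, m) * exp (of_int i * s1 + of_int j * s2 + u m - u k))"
    by (simp only: sum_distrib_left mult.left_commute)
  also have "\<dots> \<le> exp \<delta> * exp \<eta>"
    using assms(2) k by (intro mult_left_mono) (auto simp: subinvariant_def)
  finally show "(\<Sum>i\<in>H. \<Sum>j\<in>H. \<Sum>m<s0.
      A i j $$ (k, m) * exp (of_int i * s + of_int j * s2 + u m - u k)) \<le> exp (\<delta> + \<eta>)"
    by (simp add: exp_add)
qed

lemma subinvariant_step:
  assumes "nonneg_blocks s0 H H A" "subinvariant s0 A \<eta> s1 s2 u" "i \<in> H" "j \<in> H" "k < s0" "m < s0"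
  shows "A i j $$ (k, m) * exp (of_int i * s1 + of_int j * s2 + u m - u k) \<le> exp \<eta>"
proof -
  let ?f = "\<lambda>i j m. A i j $$ (k, m) * exp (of_int i * s1 + of_int j * s2 + u m - u k)"
  have nn: "0 \<le> ?f i j m" if "i \<in> H" "j \<in> H" "m < s0" for i j m
    using assms(1,5) that by (auto simp: nonneg_blocks_def)
  have "?f i j m \<le> (\<Sum>m<s0. ?f i j m)"
    using nn assms by (intro member_le_sum[where f = "?f i j"]) auto
  also have "\<dots> \<le> (\<Sum>j\<in>H. \<Sum>m<s0. ?f i j m)"
    using nn assms finite_H
    by (intro member_le_sum[where f = "\<lambda>j. \<Sum>m<s0. ?f i j m"] sum_nonneg) auto
  also have "\<dots> \<le> (\<Sum>i\<in>H. \<Sum>j\<in>H. \<Sum>m<s0. ?f i j m)"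
    using nn assms finite_H
    by (intro member_le_sum[where f = "\<lambda>i. \<Sum>j\<in>H. \<Sum>m<s0. ?f i j m"] sum_nonneg) auto
  also have "\<dots> \<le> exp \<eta>" using assms(2,5) by (simp add: subinvariant_def)
  finally show ?thesis .
qed

text \<open>Each single term of a subinvariance sum is at most exp \<eta> \<le> exp 1. Multiplied
  along the path, the exponents telescope, and the constant depends on the path alone, not on
  \<eta>, s1, s2 or \<open>u\<close>.\<close>

lemma subinvariant_path:
  assumes "nonneg_blocks s0 H H A"
    and "((x, h, k), (y, g, l)) \<in> (steps (states0 s0) (trans0 A))\<^sup>*"
  shows "\<exists>c>0. \<forall>\<eta> s1 s2 u. \<eta> \<le> 1 \<longrightarrow> subinvariant s0 A \<eta> s1 s2 u \<longrightarrow>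
    c * exp (of_int (y - x) * s1 + of_int (g - h) * s2 + u l - u k) \<le> 1"
  using assms(2)
proof (induction rule: rtrancl_induct3)
  case refl
  show ?case by (intro exI[of _ 1]) auto
next
  case (step y g l y' g' l')
  then obtain c where c: "c > 0" "\<And>\<eta> s1 s2 u. \<eta> \<le> 1 \<Longrightarrow> subinvariant s0 A \<eta> s1 s2 u \<Longrightarrow>
    c * exp (of_int (y - x) * s1 + of_int (g - h) * s2 + u l - u k) \<le> 1" by blast
  note s = step(2)[unfolded steps_trans0]
  let ?a = "A (y' - y) (g' - g) $$ (l, l')"
  have "c * ?a / exp 1 * exp (of_int (y' - x) * s1 + of_int (g' - h) * s2 + u l' - u k) \<le> 1"
    if "\<eta> \<le> 1" "subinvariant s0 A \<eta> s1 s2 u" for \<eta> s1 s2 u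
  proof -
    let ?e = "of_int (y - x) * s1 + of_int (g - h) * s2 + u l - u k"
    let ?e' = "of_int (y' - y) * s1 + of_int (g' - g) * s2 + u l' - u l"
    have "?a * exp ?e' \<le> exp 1"
      using subinvariant_step[OF assms(1) that(2), of "y' - y" "g' - g" l l'] s that(1)
      by (auto intro: order_trans)
    then have "(c * exp ?e) * (?a * exp ?e') \<le> 1 * exp 1"
      using c(2)[OF that] c(1) s by (intro mult_mono) auto
    then have "c * ?a * (exp ?e * exp ?e') \<le> exp 1" by (simp only: ac_simps mult_1)
    moreover have "exp ?e * exp ?e' = exp (of_int (y' - x) * s1 + of_int (g' - h) * s2 + u l' - u k)"
      unfolding exp_add[symmetric] by (simp add: algebra_simps)
    ultimately show ?thesis by (simp only: times_divide_eq_left pos_divide_le_eq exp_gt_zero mult_1)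
  qed
  then show ?case using c(1) s by (intro exI[of _ "c * ?a / exp 1"]) auto
qed

lemma path0:
  assumes "nonneg_blocks s0 H H A" "irreducible_chain (states0 s0) (trans0 A)" "k < s0" "k' < s0"
  shows "((x, h, k), (x', h', k')) \<in> (steps (states0 s0) (trans0 A))\<^sup>*"
proof -
  obtain n where "((x, h, k), (x', h', k')) \<in> steps (states0 s0) (trans0 A) ^^ n"
    using irreducible_chain_path[OF assms(2) trans0_nonneg[OF assms(1)],
        of "(x, h, k)" "(x', h', k')"] assms(3,4)
    by (auto simp: states0_def)
  then show ?thesis by (rule relpow_imp_rtrancl)
qed

text \<open>A path with displacement (d, 0) that returns to its phase makes the terms in s2 and
  \<open>u\<close> cancel, leaving a bound on d * s1; take d = 1 and d = -1.\<close>

lemma Gamma_region_bounded_fst: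
  assumes "0 < s0" "nonneg_blocks s0 H H A" "irreducible_chain (states0 s0) (trans0 A)"
  shows "bdd_above (fst ` Gamma_region s0 A)" "bdd_below (fst ` Gamma_region s0 A)"
proof -
  have *: "\<exists>b. \<forall>(s1, s2)\<in>Gamma_region s0 A. of_int d * s1 \<le> b" for d
  proof -
    obtain c where c: "c > 0" "\<forall>\<eta> s1 s2 u. \<eta> \<le> 1 \<longrightarrow> subinvariant s0 A \<eta> s1 s2 u \<longrightarrow>
      c * exp (of_int (d - 0) * s1 + of_int (0 - 0) * s2 + u 0 - u 0) \<le> 1"
      using subinvariant_path[OF assms(2) path0[OF assms(2,3,1,1), of 0 0 d 0]]
      by (elim exE conjE)
    have "of_int d * s1 \<le> - ln c" if in_region: "(s1, s2) \<in> Gamma_region s0 A" for s1 s2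
    proof -
      obtain u where "subinvariant s0 A 1 s1 s2 u"
        by (rule Gamma_region_subinvariant[OF assms(1,2) in_region, of 1], simp)
      from c(2)[rule_format, OF _ this] have "c * exp (of_int d * s1) \<le> 1" by simp
      then have "ln (c * exp (of_int d * s1)) \<le> 0" using c(1) by simp
      then show ?thesis using c(1) by (simp add: ln_mult)
    qed
    then show ?thesis by (intro exI[of _ "- ln c"]) auto
  qed
  obtain b where "\<forall>(s1, s2)\<in>Gamma_region s0 A. of_int 1 * s1 \<le> b"
    using *[of 1] by (elim exE)
  then show "bdd_above (fst ` Gamma_region s0 A)" by (intro bdd_aboveI[of _ b]) auto
  obtain b where "\<forall>(s1, s2)\<in>Gamma_region s0 A. of_int (- 1) * s1 \<le> b"
    using *[of "- 1"] by (elim exE)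
  then show "bdd_below (fst ` Gamma_region s0 A)" by (intro bdd_belowI[of _ "- b"]) auto
qed

text \<open>The region has a point with first coordinate a < ln r and one with b arbitrarily close
  to the supremum. If b > ln r, interpolate between the two; otherwise shift from b.\<close>

lemma exists_subinvariant:
  assumes "0 < s0" "nonneg_blocks s0 H H A" "stochastic_mat s0 (block_sum s0 H H A)"
    and irr: "irreducible_chain (states0 s0) (trans0 A)"
    and r: "0 < r" "z1_min s0 A < r" "r \<le> z1_max s0 A" and "0 < \<eta>"
  obtains s2 u where "subinvariant s0 A \<eta> (ln r) s2 u"
proof -
  let ?\<Gamma> = "Gamma_region s0 A"
  have ne: "?\<Gamma> \<noteq> {}" using zero_in_Gamma_region[OF assms(1-3)] by auto
  have "exp (INF s\<in>?\<Gamma>. fst s) < exp (ln r)" "exp (ln r) \<le> exp (SUP s\<in>?\<Gamma>. fst s)"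
    using r by (simp_all add: z1_min_def z1_max_def)
  then have lt: "(INF s\<in>?\<Gamma>. fst s) < ln r" "ln r \<le> (SUP s\<in>?\<Gamma>. fst s)"
    by (simp_all only: exp_less_cancel_iff exp_le_cancel_iff)
  have "\<exists>s\<in>?\<Gamma>. fst s < ln r"
    using lt(1) by (simp only: cINF_less_iff[OF ne Gamma_region_bounded_fst(2)[OF assms(1,2) irr]])
  then obtain a a2 where a: "(a, a2) \<in> ?\<Gamma>" "a < ln r" by force
  \<comment> \<open>Half of \<eta> is reserved for the distance from b up to ln r, which covers the
    case that ln r is the right end point.\<close>
  have "ln r - \<eta> / 2 < (SUP s\<in>?\<Gamma>. fst s)" using lt(2) \<open>0 < \<eta>\<close> by linarith
  then have "\<exists>s\<in>?\<Gamma>. ln r - \<eta> / 2 < fst s"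
    by (simp only: less_cSUP_iff[OF ne Gamma_region_bounded_fst(1)[OF assms(1,2) irr]])
  then obtain b b2 where b: "(b, b2) \<in> ?\<Gamma>" "ln r - \<eta> / 2 < b" by force
  obtain u where u: "subinvariant s0 A (\<eta> / 2) a a2 u"
    by (rule Gamma_region_subinvariant[OF assms(1,2) a(1) half_gt_zero[OF \<open>0 < \<eta>\<close>]])
  obtain v where v: "subinvariant s0 A (\<eta> / 2) b b2 v"
    by (rule Gamma_region_subinvariant[OF assms(1,2) b(1) half_gt_zero[OF \<open>0 < \<eta>\<close>]])
  consider "b \<le> ln r" | "ln r < b" by linarith
  then show thesis
  proof cases
    case 1
    then have "subinvariant s0 A (\<eta> / 2 + \<eta> / 2) (ln r) b2 v"
      using b(2) by (intro subinvariant_shift[OF assms(2) v]) auto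
    then show ?thesis using that by simp
  next
    case 2
    define t where "t = (ln r - a) / (b - a)"
    have t: "0 \<le> t" "t \<le> 1" "t * (b - a) = ln r - a"
      using 2 a(2) by (simp_all add: t_def)
    have e: "(1 - t) * a + t * b = ln r" using t(3) by (simp add: algebra_simps)
    have "subinvariant s0 A (\<eta> / 2) (ln r) ((1 - t) * a2 + t * b2) (\<lambda>k. (1 - t) * u k + t * v k)"
      using subinvariant_convex[OF assms(2) u v t(1,2)] unfolding e .
    \<comment> \<open>A shift over distance 0, used only to raise \<eta> / 2 to \<eta>.\<close>
    from subinvariant_shift[OF assms(2) this, of "ln r" "\<eta> / 2"] that show ?thesis
      using \<open>0 < \<eta>\<close> by simp
  qed
qed

section \<open>Bounds for sums over descents\<close>

lemma sum_level_weight_le: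
  assumes "subinvariant s0 A \<eta> s1 s2 u" "k < s0"
  shows "(\<Sum>j\<in>H. \<Sum>m<s0. level_weight A (exp s1) j k m * exp (of_int j * s2 + u m)) \<le> exp (\<eta> + u k)"
proof -
  have e: "a * exp s1 powi i * exp (of_int j * s2 + u m)
      = a * exp (of_int i * s1 + of_int j * s2 + u m - u k) * exp (u k)" for a i j m
  proof -
    have "exp (of_int i * s1) * exp (of_int j * s2 + u m)
      = exp (of_int i * s1 + of_int j * s2 + u m - u k) * exp (u k)"
      unfolding exp_add[symmetric] by (simp add: algebra_simps)
    then show ?thesis by (simp only: exp_power_int mult.assoc)
  qed
  have "(\<Sum>j\<in>H. \<Sum>m<s0. level_weight A (exp s1) j k m * exp (of_int j * s2 + u m))
    = (\<Sum>j\<in>H. \<Sum>m<s0. \<Sum>i\<in>H.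
        A i j $$ (k, m) * exp (of_int i * s1 + of_int j * s2 + u m - u k) * exp (u k))"
    by (simp only: level_weight_def sum_distrib_right e)
  also have "\<dots> = (\<Sum>i\<in>H. \<Sum>j\<in>H. \<Sum>m<s0.
        A i j $$ (k, m) * exp (of_int i * s1 + of_int j * s2 + u m - u k)) * exp (u k)"
    by (subst sum_rotate) (simp only: sum_distrib_right)
  also have "\<dots> \<le> exp \<eta> * exp (u k)"
    using assms by (intro mult_right_mono) (auto simp: subinvariant_def)
  finally show ?thesis by (simp add: exp_add)
qed

lemma finite_descents: "finite {js. length js \<le> N \<and> descent h js}"
  by (rule finite_subset[OF _ finite_lists_length_le[OF finite_H, of N]])
    (auto dest: descent_subset)

text \<open>A supermartingale argument: the function exp (h s2 + u k) of height and phase grows by a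
  factor of at most exp \<eta> per step, and equals exp (u l) on arrival at height 0 in phase
  l.\<close>

lemma sum_descents_le:
  assumes A: "nonneg_blocks s0 H H A" and S: "subinvariant s0 A \<eta> s1 s2 u" and l: "l < s0" and "0 \<le> \<eta>"
    and "k < s0"
  shows "(\<Sum>js | length js \<le> N \<and> descent h js. path_weight s0 A (exp s1) js k l) * exp (u l)
    \<le> exp (\<eta> * N) * exp (of_int h * s2 + u k)"
  using \<open>k < s0\<close>
proof (induction N arbitrary: h k)
  case 0
  have D: "{js. length js \<le> 0 \<and> descent h js} = (if h = 0 then {[]} else {})"
    by (cases "h = 0") auto
  show ?case unfolding D by (cases "h = 0") auto
next
  case (Suc N)
  let ?D = "\<lambda>N h. {js. length js \<le> N \<and> descent h js}"
  consider "h = 0" | "h < 0" | "1 \<le> h" by linarith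
  then show ?case
  proof cases
    case 1
    have "js = []" if "descent h js" for js using that 1 by (cases js) auto
    then have D: "?D (Suc N) h = {[]}" using 1 by auto
    have "1 \<le> exp (\<eta> * Suc N)" using \<open>0 \<le> \<eta>\<close> by simp
    then show ?thesis unfolding D using 1 by auto
  next
    case 2
    have "\<not> descent h js" for js using 2 by (cases js) auto
    then show ?thesis by simp
  next
    case 3
    \<comment> \<open>Decomposition by the first jump, which leaves at most N jumps from height h +
      j.\<close>
    have D: "?D (Suc N) h = (\<lambda>(j, js). j # js) ` (SIGMA j:H. ?D N (h + j))"
    proof (intro equalityI subsetI)
      fix js assume "js \<in> ?D (Suc N) h"
      then show "js \<in> (\<lambda>(j, js). j # js) ` (SIGMA j:H. ?D N (h + j))"
        using 3 by (cases js) force+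
    qed (use 3 in auto)
    have "(\<Sum>js\<in>?D (Suc N) h. path_weight s0 A (exp s1) js k l)
      = (\<Sum>j\<in>H. \<Sum>js\<in>?D N (h + j). path_weight s0 A (exp s1) (j # js) k l)"
      unfolding D by (subst sum.reindex) (auto simp: inj_on_def sum.Sigma finite_H finite_descents
          case_prod_beta simp del: path_weight.simps)
    also have "\<dots> = (\<Sum>j\<in>H. \<Sum>m<s0. level_weight A (exp s1) j k m * (\<Sum>js\<in>?D N (h + j). path_weight s0 A (exp s1) js m l))"
      by (intro sum.cong refl) (simp add: sum_distrib_left sum.swap[of _ "{..<s0}"])
    finally have "(\<Sum>js\<in>?D (Suc N) h. path_weight s0 A (exp s1) js k l) * exp (u l) = (\<Sum>j\<in>H. \<Sum>m<s0.
        level_weight A (exp s1) j k m * ((\<Sum>js\<in>?D N (h + j). path_weight s0 A (exp s1) js m l) * exp (u l)))"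
      by (simp add: sum_distrib_right mult.assoc)
    also have "\<dots> \<le> (\<Sum>j\<in>H. \<Sum>m<s0.
        level_weight A (exp s1) j k m * (exp (\<eta> * N) * exp (of_int (h + j) * s2 + u m)))"
      using Suc.prems by (intro sum_mono mult_left_mono Suc.IH level_weight_nonneg[OF A]) auto
    also have "\<dots> = exp (\<eta> * N + of_int h * s2) *
        (\<Sum>j\<in>H. \<Sum>m<s0. level_weight A (exp s1) j k m * exp (of_int j * s2 + u m))"
      unfolding sum_distrib_left by (intro sum.cong refl) (simp add: exp_add algebra_simps)
    also have "\<dots> \<le> exp (\<eta> * N + of_int h * s2) * exp (\<eta> + u k)"
      using sum_level_weight_le[OF S Suc.prems] by (intro mult_left_mono) auto
    finally show ?thesis by (simp add: exp_add[symmetric] algebra_simps)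
  qed
qed

text \<open>For the partial sum of order \<open>N\<close> one takes \<open>\<eta> = 1 / (N + 1)\<close>, so that the factor
  \<open>exp (\<eta> N)\<close> stays bounded.\<close>

lemma summable_first_passage:
  assumes "0 < s0" and A: "nonneg_blocks s0 H H A"
    and "stochastic_mat s0 (block_sum s0 H H A)"
    and irr: "irreducible_chain (states0 s0) (trans0 A)"
    and r: "0 < r" "z1_min s0 A < r" "r \<le> z1_max s0 A" and kl: "k < s0" "l < s0"
  shows "summable (\<lambda>n. \<Sum>js\<in>first_passage (Suc n). path_weight s0 A r js k l)"
proof -
  \<comment> \<open>A path from height 0 in phase l to height 1 in phase k bounds exp (s2 + u k - u
    l) by 1 / c, uniformly in the choice of \<eta>, s2 and \<open>u\<close>.\<close>
  obtain c where c: "c > 0" "\<forall>\<eta> s1 s2 u. \<eta> \<le> 1 \<longrightarrow> subinvariant s0 A \<eta> s1 s2 u \<longrightarrow>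
      c * exp (of_int (0 - 0) * s1 + of_int (1 - 0) * s2 + u k - u l) \<le> 1"
    using subinvariant_path[OF A path0[OF A irr kl(2,1), of 0 0 0 1]]
    by (elim exE conjE)
  have nn: "0 \<le> path_weight s0 A r js k l" if "set js \<subseteq> H" for js
    using path_weight_nonneg[OF A that kl] r by simp
  show ?thesis
  proof (rule bounded_imp_summable[where B = "exp 1 / c"])
    fix n show "0 \<le> (\<Sum>js\<in>first_passage (Suc n). path_weight s0 A r js k l)"
      by (intro sum_nonneg nn) (simp add: first_passage_def)
  next
    fix n
    \<comment> \<open>The partial sum up to index n comprises the passages of lengths 1 to n +
      1.\<close>
    define N where "N = Suc n"
    define \<eta> where "\<eta> = 1 / real (Suc N)"
    have \<eta>: "0 < \<eta>" "\<eta> \<le> 1" "\<eta> * N \<le> 1" by (auto simp: \<eta>_def field_simps)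
    obtain s2 u where S: "subinvariant s0 A \<eta> (ln r) s2 u"
      using exists_subinvariant[OF assms(1-4) r \<eta>(1)] .
    have "(\<Sum>i\<le>n. \<Sum>js\<in>first_passage (Suc i). path_weight s0 A r js k l)
      = (\<Sum>js\<in>(\<Union>i\<le>n. first_passage (Suc i)). path_weight s0 A r js k l)"
      by (intro sum.UNION_disjoint[symmetric] ballI finite_first_passage)
        (auto simp: first_passage_def)
    also have "\<dots> \<le> (\<Sum>js | length js \<le> N \<and> descent 1 js. path_weight s0 A r js k l)"
      by (intro sum_mono2 finite_descents nn) (auto simp: first_passage_Suc N_def dest: descent_subset)
    also have "\<dots> \<le> exp (\<eta> * N) * exp (s2 + u k - u l)"
      using sum_descents_le[OF A S kl(2) _ kl(1), where N = N and h = 1] \<eta> r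
      by (simp add: exp_diff pos_le_divide_eq)
    also have "\<dots> \<le> exp 1 * (1 / c)"
      using c(2)[rule_format, OF \<eta>(2) S] c(1) \<eta> by (intro mult_mono) (auto simp: pos_le_divide_eq mult.commute)
    finally show "(\<Sum>i\<le>n. \<Sum>js\<in>first_passage (Suc i). path_weight s0 A r js k l) \<le> exp 1 / c" by simp
  qed
qed

section \<open>Excursions from the boundary\<close>

text \<open>The bounds on |z| enter only through the summability assumption, which separates the
  study of excursions from that of convergence.\<close>

locale boundary_walk =
  fixes s0 :: nat and A A1 :: "int \<Rightarrow> int \<Rightarrow> real mat" and z :: complex
  assumes s0: "0 < s0"
    and A: "nonneg_blocks s0 H H A"
    and A1: "nonneg_blocks s0 H Hplus A1"
    and z: "z \<noteq> 0"
    and irr0: "irreducible_chain (states0 s0) (trans0 A)"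
    and irr1: "irreducible_chain (states1 s0) (trans1 A A1)"
    and summable_path_weight: "\<And>k l. k < s0 \<Longrightarrow> l < s0 \<Longrightarrow>
      summable (\<lambda>n. \<Sum>js\<in>first_passage (Suc n). path_weight s0 A (cmod z) js k l)"
begin

text \<open>The entries of G_1(|z|); \<open>q\<close> below holds those of C_1(|z|,
  G_1(|z|)).\<close>

definition g :: "nat \<Rightarrow> nat \<Rightarrow> real" where
  "g k l = (\<Sum>n. \<Sum>js\<in>first_passage (Suc n). path_weight s0 A (cmod z) js k l)"

definition q :: "nat \<Rightarrow> nat \<Rightarrow> real" where
  "q k l = level_weight A1 (cmod z) 0 k l + (\<Sum>m<s0. level_weight A1 (cmod z) 1 k m * g m l)"

abbreviation M :: "complex mat" where "M \<equiv> C1 s0 A1 z (G1 s0 A z)"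

section \<open>Domination of C_1(z, G_1(z)) by its value at |z|\<close>

lemma first_passage_subset: "js \<in> first_passage n \<Longrightarrow> set js \<subseteq> H"
  by (simp add: first_passage_def)

lemma sum_first_passage_norm_le:
  assumes "k < s0" "l < s0"
  shows "cmod (\<Sum>js\<in>first_passage n. path_prod s0 A z js $$ (k, l))
    \<le> (\<Sum>js\<in>first_passage n. path_weight s0 A (cmod z) js k l)"
  using assms by (intro sum_norm_le norm_path_prod_le A first_passage_subset)

lemma norm_G1_le:
  assumes "k < s0" "l < s0"
  shows "cmod (G1 s0 A z $$ (k, l)) \<le> g k l"
  using norm_suminf_le[OF sum_first_passage_norm_le[OF assms] summable_path_weight[OF assms]] assms
  by (simp add: G1_def g_def)

lemma G1_of_real:
  assumes "k < s0" "l < s0"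
  shows "G1 s0 A (of_real (cmod z)) $$ (k, l) = of_real (g k l)"
  using assms by (simp add: G1_def g_def path_prod_of_real flip: of_real_sum)
    (rule suminf_of_real[OF summable_path_weight[OF assms], symmetric])

text \<open>One aligned first passage suffices: all other terms of the series are dominated.\<close>

lemma aligned_G1:
  assumes "descent 1 js" "k < s0" "l < s0"
    "aligned (path_prod s0 A z js $$ (k, l)) (path_weight s0 A (cmod z) js k l) t"
  shows "aligned (G1 s0 A z $$ (k, l)) (g k l) t"
proof -
  obtain n where n: "length js = Suc n" using assms(1) by (cases js) auto
  have "aligned (\<Sum>js\<in>first_passage (Suc n). path_prod s0 A z js $$ (k, l))
      (\<Sum>js\<in>first_passage (Suc n). path_weight s0 A (cmod z) js k l) t"
    using assms n by (intro aligned_sum[where i = js] finite_first_passage)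
      (auto simp: first_passage_Suc intro!: norm_path_prod_le A dest: descent_subset)
  from aligned_suminf[OF summable_path_weight[OF assms(2,3)] this sum_first_passage_norm_le[OF assms(2,3)]]
  show ?thesis using assms by (simp add: G1_def g_def)
qed

lemma G1_carrier: "G1 s0 A w \<in> carrier_mat s0 s0"
  by (simp add: G1_def)

lemma C1_index:
  assumes "k < s0" "l < s0"
  shows "C1 s0 A1 w (G1 s0 A w) $$ (k, l) = Astar s0 A1 0 w $$ (k, l) +
    (\<Sum>m<s0. Astar s0 A1 1 w $$ (k, m) * G1 s0 A w $$ (m, l))"
  using assms index_mult_mat_sum[OF Astar_carrier G1_carrier, of k l A1 1 w w]
    mult_carrier_mat[OF Astar_carrier G1_carrier, of A1 1 w w]
    carrier_matD[OF Astar_carrier] carrier_matD[OF G1_carrier]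
  by (simp add: C1_def)

lemma C1_carrier: "C1 s0 A1 w (G1 s0 A w) \<in> carrier_mat s0 s0"
  using mult_carrier_mat[OF Astar_carrier G1_carrier, of A1 1 w w] by (simp add: C1_def)

lemma norm_M_terms:
  assumes "k < s0" "l < s0"
  shows "cmod (Astar s0 A1 0 z $$ (k, l)) \<le> level_weight A1 (cmod z) 0 k l"
    "m < s0 \<Longrightarrow> cmod (Astar s0 A1 1 z $$ (k, m) * G1 s0 A z $$ (m, l))
      \<le> level_weight A1 (cmod z) 1 k m * g m l"
  using assms
  by (auto simp: norm_mult Hplus_def intro!: mult_mono norm_Astar_le[OF A1] level_weight_nonneg[OF A1] norm_G1_le)

lemma norm_M_le:
  assumes "k < s0" "l < s0"
  shows "cmod (M $$ (k, l)) \<le> q k l"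
  unfolding C1_index[OF assms] q_def using assms norm_M_terms[OF assms]
  by (intro norm_triangle_le add_mono sum_norm_le) auto

lemma C1_of_real:
  assumes "k < s0" "l < s0"
  shows "C1 s0 A1 (of_real (cmod z)) (G1 s0 A (of_real (cmod z))) $$ (k, l) = of_real (q k l)"
  using assms by (simp add: C1_index q_def Astar_of_real G1_of_real)

text \<open>\<open>d\<close> stands for the horizontal displacement of a descent from height
  \<open>h\<close> to 0. Path weights already sum over horizontal jumps and intermediate phases, so
  the displacement is recorded by the phase factor (sgn z)^d.\<close>

definition descends :: "int \<Rightarrow> nat \<Rightarrow> nat \<Rightarrow> int \<Rightarrow> bool" where
  "descends h k l d \<longleftrightarrow> k < s0 \<and> l < s0 \<and> (\<exists>js. descent h js \<and>
     aligned (path_prod s0 A z js $$ (k, l)) (path_weight s0 A (cmod z) js k l) (sgn z powi d))"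

lemma descends_refl: "k < s0 \<Longrightarrow> descends 0 k k 0"
  unfolding descends_def by (auto simp: path_prod_Nil aligned_one intro!: exI[of _ "[]"])

lemma descends_step:
  assumes "descends (h + j) m l d" "1 \<le> h" "i \<in> H" "j \<in> H" "k < s0" "0 < A i j $$ (k, m)"
  shows "descends h k l (i + d)"
proof -
  obtain js where js: "descent (h + j) js" "m < s0" "l < s0"
    "aligned (path_prod s0 A z js $$ (m, l)) (path_weight s0 A (cmod z) js m l) (sgn z powi d)"
    using assms(1) by (auto simp: descends_def)
  have "aligned (path_prod s0 A z (j # js) $$ (k, l)) (path_weight s0 A (cmod z) (j # js) k l)
    (sgn z powi (i + d))"
    using js assms descent_subset[OF js(1)] by (intro aligned_path_prod_Cons[where m = m] A z) auto
  then show ?thesis using js assms unfolding descends_def by (intro conjI exI[of _ "j # js"]) auto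
qed

text \<open>A boundary step followed by a descent is an excursion; it contributes to one entry of
  \<open>M\<close> with total displacement i + d.\<close>

lemma descends_excursion:
  assumes "descends j m l d" "i \<in> H" "j \<in> Hplus" "k < s0" "0 < A1 i j $$ (k, m)"
  shows "aligned (M $$ (k, l)) (q k l) (sgn z powi (i + d))"
proof -
  obtain js where js: "descent j js" "m < s0" "l < s0"
    "aligned (path_prod s0 A z js $$ (m, l)) (path_weight s0 A (cmod z) js m l) (sgn z powi d)"
    using assms(1) by (auto simp: descends_def)
  have sz: "sgn z \<noteq> 0" using z by (simp add: sgn_zero_iff)
  note terms = norm_M_terms[OF assms(4) js(3)]
  consider "j = 0" | "j = 1" using assms(3) by (auto simp: Hplus_def)
  then show ?thesis
  proof cases
    case 1
    \<comment> \<open>The excursion is a single step along level 0. The weight of the empty descent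
      is positive only if m = l, and its phase is 1.\<close>
    then have "js = []" using js(1) by (cases js) auto
    then have "m = l" "sgn z powi d = 1"
      using js(4) aligned_pos[OF js(4)] js(2,3)
      by (auto simp: path_prod_Nil aligned_one split: if_splits)
    then have "aligned (Astar s0 A1 0 z $$ (k, l)) (level_weight A1 (cmod z) 0 k l) (sgn z powi (i + d))"
      using aligned_Astar[OF A1, of 0 i k l z] assms js 1 z sz by (simp add: power_int_add)
    then show ?thesis
      unfolding C1_index[OF assms(4) js(3)] q_def
      using terms by (intro aligned_add sum_norm_le) auto
  next
    case 2
    then have "aligned (G1 s0 A z $$ (m, l)) (g m l) (sgn z powi d)"
      using js by (intro aligned_G1) auto
    then have "aligned (Astar s0 A1 1 z $$ (k, m) * G1 s0 A z $$ (m, l))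
       (level_weight A1 (cmod z) 1 k m * g m l) (sgn z powi (i + d))"
      using assms js 2 z sz by (subst power_int_add) (auto intro!: aligned_mult aligned_Astar[OF A1])
    then have "aligned (\<Sum>m<s0. Astar s0 A1 1 z $$ (k, m) * G1 s0 A z $$ (m, l))
       (\<Sum>m<s0. level_weight A1 (cmod z) 1 k m * g m l) (sgn z powi (i + d))"
      using js(2) terms by (intro aligned_sum[where i = m]) auto
    then show ?thesis
      unfolding C1_index[OF assms(4) js(3)] q_def
      using terms(1) by (intro aligned_add')
  qed
qed

section \<open>Irreducibility of the dominating matrix\<close>

abbreviation Q_steps :: "(nat \<times> nat) set" where
  "Q_steps \<equiv> {(k, l). k < s0 \<and> l < s0 \<and> 0 < q k l}"

text \<open>The path is read from its end: steps from positive heights are prepended to the current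
  descent; a step from level 0 closes it to an excursion, hence a positive entry of
  \<open>q\<close>, and an empty descent starts anew.\<close>

lemma descends_to_boundary:
  assumes "((x, h, k), (y, 0, l)) \<in> (steps (states1 s0) (trans1 A A1))\<^sup>*" "l < s0"
  shows "\<exists>m d. descends h k m d \<and> (m, l) \<in> Q_steps\<^sup>*"
  using assms(1)
proof (induction rule: converse_rtrancl_induct3)
  case refl
  then show ?case using descends_refl[OF assms(2)] by blast
next
  case (step x h k x' h' k')
  then obtain m d where md: "descends h' k' m d" "(m, l) \<in> Q_steps\<^sup>*" by blast
  note s = steps_trans1[OF step(1)]
  show ?case
  proof (cases "h = 0")
    case True
    then have "aligned (M $$ (k, m)) (q k m) (sgn z powi (x' - x + d))"
      using s md by (intro descends_excursion[of h' k' m d]) auto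
    then have "(k, m) \<in> Q_steps" using md(1) s by (auto simp: descends_def dest: aligned_pos)
    then have "(k, l) \<in> Q_steps\<^sup>*" using md(2) by (rule converse_rtrancl_into_rtrancl)
    then show ?thesis using descends_refl[OF s(1)] True by blast
  next
    case False
    then have "descends h k m (x' - x + d)"
      using s md by (intro descends_step[of h "h' - h" k']) auto
    then show ?thesis using md(2) by blast
  qed
qed

lemma path1:
  assumes "0 \<le> h" "0 \<le> h'" "k < s0" "k' < s0"
  shows "((x, h, k), (x', h', k')) \<in> (steps (states1 s0) (trans1 A A1))\<^sup>*"
proof -
  obtain n where "((x, h, k), (x', h', k')) \<in> steps (states1 s0) (trans1 A A1) ^^ n"
    using irreducible_chain_path[OF irr1 trans1_nonneg[OF A A1], of "(x, h, k)" "(x', h', k')"] assms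
    by (auto simp: states1_def)
  then show ?thesis by (rule relpow_imp_rtrancl)
qed

lemma Q_irreducible:
  assumes "k < s0" "l < s0"
  shows "(k, l) \<in> Q_steps\<^sup>*"
proof -
  obtain m d where md: "descends 0 k m d" "(m, l) \<in> Q_steps\<^sup>*"
    using descends_to_boundary[OF path1[of 0 0 k l 0 0]] assms by auto
  then obtain js where js: "descent 0 js" "0 < path_weight s0 A (cmod z) js k m"
    by (auto simp: descends_def dest: aligned_pos)
  \<comment> \<open>A descent from height 0 is empty, so positivity of its weight gives m =
    k.\<close>
  then have "js = []" by (cases js) auto
  then show ?thesis using js md by (auto split: if_splits)
qed

text \<open>A walk of length \<open>n\<close> can be lifted to a height from which it cannot reach the boundary.\<close>

lemma descends_loop:
  assumes "((x, h, k), (x', 0, k')) \<in> steps (states0 s0) (trans0 A) ^^ n" "descends L k' l d"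
    "int n < L"
  shows "- int n \<le> h \<and> descends (h + L) k l (x' - x + d)"
  using assms(1,3)
proof (induction n arbitrary: x h k)
  case 0
  then show ?case using assms(2) by simp
next
  case (Suc n)
  then obtain y i m where s: "((x, h, k), (y, i, m)) \<in> steps (states0 s0) (trans0 A)"
    and n: "((y, i, m), (x', 0, k')) \<in> steps (states0 s0) (trans0 A) ^^ n"
    by (metis prod_cases3 relpow_Suc_D2)
  have IH: "- int n \<le> i" "descends (i + L) m l (x' - y + d)" using Suc.IH[OF n] Suc.prems by auto
  note s' = s[unfolded steps_trans0]
  have "i - h \<le> 1" using s' by (auto simp: H_def)
  \<comment> \<open>Together with Suc n < L this yields h + L \<ge> 1, so prepending the step is
    legitimate.\<close>
  then have h: "- int (Suc n) \<le> h" using IH(1) by linarith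
  have "descends (h + L) k l ((y - x) + (x' - y + d))"
    using s' IH h Suc.prems
    by (intro descends_step[of "h + L" "i - h" m]) (auto simp: algebra_simps)
  moreover have "(y - x) + (x' - y + d) = x' - x + d" by simp
  ultimately show ?case using h by simp
qed

text \<open>Two descents with equal end phases and displacements d and d + 1 are extended backwards
  along the path by the same steps. At a step from level 0 both become excursions for the same entry
  of \<open>M\<close>, with phases differing by sgn z; this alternative then persists.\<close>

lemma descends_split:
  assumes "((x, h, k), (y, L, l)) \<in> (steps (states1 s0) (trans1 A A1))\<^sup>*" "1 \<le> L" "l < s0"
    "descends L l b d" "descends L l b (d + 1)"
  shows "(\<exists>a b t. a < s0 \<and> b < s0 \<and> aligned (M $$ (a, b)) (q a b) t \<and>
      aligned (M $$ (a, b)) (q a b) (sgn z * t)) \<or>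
    1 \<le> h \<and> (\<exists>b d. descends h k b d \<and> descends h k b (d + 1))"
  using assms(1)
proof (induction rule: converse_rtrancl_induct3)
  case refl
  then show ?case using assms by blast
next
  case (step x h k x' h' k')
  note s = steps_trans1[OF step(1)]
  from step(3) consider "\<exists>a b t. a < s0 \<and> b < s0 \<and> aligned (M $$ (a, b)) (q a b) t \<and>
      aligned (M $$ (a, b)) (q a b) (sgn z * t)"
    | b d where "1 \<le> h'" "descends h' k' b d" "descends h' k' b (d + 1)" by blast
  then show ?case
  proof cases
    case (2 b d)
    show ?thesis
    proof (cases "h = 0")
      case True
      then have "aligned (M $$ (k, b)) (q k b) (sgn z powi (x' - x + d))"
        "aligned (M $$ (k, b)) (q k b) (sgn z powi (x' - x + (d + 1)))"
        using s 2 by (auto intro!: descends_excursion[of h' k'])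
      moreover have "sgn z powi (x' - x + (d + 1)) = sgn z * sgn z powi (x' - x + d)"
        using z power_int_add_1'[of "sgn z" "x' - x + d"]
        by (simp add: sgn_zero_iff add.assoc)
      ultimately show ?thesis using s 2 by (auto simp: descends_def)
    next
      case False
      then have "descends h k b (x' - x + d)" "descends h k b (x' - x + (d + 1))"
        using s 2 by (auto intro!: descends_step[of h "h' - h" k'])
      then show ?thesis using False s by (metis add.assoc int_one_le_iff_zero_less less_le)
    qed
  qed simp
qed

text \<open>Inserting a loop with displacement \<open>1\<close> high above the boundary into an excursion yields a
  second excursion with the same end phases, whose phase factor differs by \<open>sgn z \<noteq> 1\<close>.\<close>

lemma M_strict:
  assumes "sgn z \<noteq> 1"
  obtains a b where "a < s0" "b < s0" "cmod (M $$ (a, b)) < q a b"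
proof -
  obtain n where n: "((0, 0, 0), (1, 0, 0)) \<in> steps (states0 s0) (trans0 A) ^^ n"
    using irreducible_chain_path[OF irr0 trans0_nonneg[OF A], of "(0, 0, 0)" "(1, 0, 0)"] s0
    by (auto simp: states0_def)
  \<comment> \<open>One more than the length of the loop, so that the lifted loop stays above level
    0.\<close>
  define L where "L = int n + 1"
  obtain m d where d: "descends L 0 m d"
    using descends_to_boundary[OF path1[of L 0 0 0 0 0]] s0 by (auto simp: L_def)
  have "descends L 0 m (d + 1)"
    using descends_loop[OF n d] by (simp add: L_def add.commute)
  \<comment> \<open>The path starts at height 0, which rules out the second alternative.\<close>
  with descends_split[OF path1[of 0 L 0 0 0 0], of m d] d s0
  obtain a b t where ab: "a < s0" "b < s0" "aligned (M $$ (a, b)) (q a b) t"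
      "aligned (M $$ (a, b)) (q a b) (sgn z * t)"
    by (auto simp: L_def)
  \<comment> \<open>\<open>descends_split\<close> does not record that t is nonzero. If t = 0,
    equality in the bound would make the entry 0, against the positivity of
    \<open>q a b\<close>.\<close>
  show thesis
  proof (cases "t = 0")
    case True
    then have "cmod (M $$ (a, b)) \<noteq> q a b" using ab(3) by (auto simp: aligned_def)
    then show ?thesis using that ab norm_M_le by (simp add: less_le)
  next
    case False
    then have "t \<noteq> sgn z * t" using assms by simp
    then show ?thesis using that ab aligned_distinct_strict by blast
  qed
qed

end

section \<open>Comparison of the two spectral radii\<close>

theorem proposition5p2:
  fixes s0 :: nat
    and A A1 A2 :: "int \<Rightarrow> int \<Rightarrow> real mat"
    and z :: complex
  assumes "0 < s0"
    and "nonneg_blocks s0 H H A"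
    and "nonneg_blocks s0 H Hplus A1"
    and "nonneg_blocks s0 Hplus H A2"
    and "stochastic_mat s0 (block_sum s0 H H A)"
    and "stochastic_mat s0 (block_sum s0 H Hplus A1)"
    and "stochastic_mat s0 (block_sum s0 Hplus H A2)"
    and "irreducible_chain (states0 s0) (trans0 A)"
    and "aperiodic_chain (states0 s0) (trans0 A)"
    and "irreducible_chain (states1 s0) (trans1 A A1)"
    and "aperiodic_chain (states1 s0) (trans1 A A1)"
    and "irreducible_chain (states2 s0) (trans2 A A2)"
    and "aperiodic_chain (states2 s0) (trans2 A A2)"
    and "z1_min s0 A < cmod z"
    and "cmod z \<le> z1_max s0 A"
    and "z \<noteq> complex_of_real (cmod z)"
  shows "spectral_radius (C1 s0 A1 z (G1 s0 A z))
       < spectral_radius (C1 s0 A1 (complex_of_real (cmod z)) (G1 s0 A (complex_of_real (cmod z))))"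
proof -
  have z: "z \<noteq> 0" using assms(16) by auto
  interpret boundary_walk s0 A A1 z
  proof
    show "summable (\<lambda>n. \<Sum>js\<in>first_passage (Suc n). path_weight s0 A (cmod z) js k l)"
      if "k < s0" "l < s0" for k l
      using summable_first_passage[OF assms(1,2,5,8) _ assms(14,15) that] z by simp
  qed (fact assms z)+
  have "sgn z \<noteq> 1" using assms(16) z by (auto simp: sgn_eq)
  then obtain a b where ab: "a < s0" "b < s0" "cmod (M $$ (a, b)) < q a b" by (rule M_strict)
  have "C1 s0 A1 (of_real (cmod z)) (G1 s0 A (of_real (cmod z))) = cmat s0 q"
    using C1_carrier[of "of_real (cmod z)"] by (intro eq_matI) (auto simp: C1_of_real)
  then show ?thesis
    using spectral_radius_strict_mono[OF assms(1) C1_carrier norm_M_le Q_irreducible ab] by simp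
qed

end
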